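(* Let $\mathcal{M}$ be a $\mathbb{Z}$-graded unitary magma and $\theta:\mathcal{M}\to\mathbb{Z}$ be a rank function of $\mathcal{M}$. The linear map $\mathrm{F}_\theta$ is an operad morphism from $\mathsf{C}\mathcal{M}$ to $\mathsf{RatFct}$.
   Context: Let $\mathbb{K}$ be a field of characteristic zero and $[n]=\{1,\dots,n\}$. A unitary magma is a set $\mathcal{M}$ with a binary operation $\star$ (not assumed associative) having a two-sided unit $\mathbb{1}_{\mathcal{M}}$. A $\mathbb{Z}$-graded unitary magma is a unitary magma admitting a unitary magma morphism $\theta:\mathcal{M}\to\mathbb{Z}$ (with $\mathbb{Z}$ additive); such a $\theta$ is a rank function. Operads are nonsymmetric operads in $\mathbb{K}$-vector spaces (graded from arity $1$, with partial compositions $\circ_i$ and a unit of arity $1$); operad morphisms are linear maps that respect arities, units and partial compositions. An $\mathcal{M}$-clique of arity $n\ge1$ is a map $\mathfrak{p}$ assigning a label $\mathfrak{p}(x,y)\in\mathcal{M}$ to each arc $(x,y)$, $1\le x<y\le n+1$; by convention the only $\mathcal{M}$-clique of arity $1$ is $\mathbf{u}$, with $\mathbf{u}(1,2)=\mathbb{1}_{\mathcal{M}}$. Write $\mathfrak{p}_0:=\mathfrak{p}(1,n+1)$ and $\mathfrak{p}_i:=\mathfrak{p}(i,i+1)$ for $i\in[n]$. $\mathsf{C}\mathcal{M}$ is the operad (with unit $\mathbf{u}$) such that $\mathsf{C}\mathcal{M}(n)$ has basis the $\mathcal{M}$-cliques of arity $n$, and for $\mathcal{M}$-cliques $\mathfrak{p},\mathfrak{q}$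 of arities $n,m$ and $i\in[n]$, $\mathfrak{p}\circ_i\mathfrak{q}$ is the $\mathcal{M}$-clique of arity $n+m-1$ with, for $1\le x<y\le n+m$, $$(\mathfrak{p}\circ_i\mathfrak{q})(x,y)=\begin{cases}\mathfrak{p}(x,y)&\text{if }y\le i,\\ \mathfrak{p}(x,y-m+1)&\text{if }x\le i<i+m\le y,\ (x,y)\ne(i,i+m),\\ \mathfrak{p}(x-m+1,y-m+1)&\text{if }i+m\le x,\\ \mathfrak{q}(x-i+1,y-i+1)&\text{if }i\le x<y\le i+m,\ (x,y)\ne(i,i+m),\\ \mathfrak{p}_i\star\mathfrak{q}_0&\text{if }(x,y)=(i,i+m),\\ \mathbb{1}_{\mathcal{M}}&\text{otherwise}.\end{cases}$$ $\mathsf{RatFct}$ is the operad with $\mathsf{RatFct}(n)=\mathbb{K}(u_1,\dots,u_n)$ (commutative rational functions), graded so that each element has a fixed arity, with unit the constant function $1\in\mathsf{RatFct}(1)$ and, for $f\in\mathsf{RatFct}(n)$, $g\in\mathsf{RatFct}(m)$, $i\in[n]$, $$f\circ_i g=f(u_1,\dots,u_{i-1},u_i+\dots+u_{i+m-1},u_{i+m},\dots,u_{n+m-1})\;g(u_i,\dots,u_{i+m-1}).$$ The map $\mathrm{F}_\theta:\mathsf{C}\mathcal{M}\to\mathsf{RatFct}$ is the linear map defined on an $\mathcal{M}$-clique $\mathfrak{p}$ of arity $n$ by $$\mathrm{F}_\theta(\mathfrak{p})=\prod_{1\le x<y\le n+1}(u_x+\dots+u_{y-1})^{\theta(\mathfrak{p}(x,y))}\in\mathsf{RatFct}(n).$$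 *)

theory Defs
  imports
    Complex_Main
    "HOL-Library.Poly_Mapping"
    "HOL-Library.FuncSet"
    "HOL-Computational_Algebra.Fraction_Field"
    "HOL-Algebra.Elementary_Groups"
begin

section \<open>Unitary magmas and rank functions\<close>

text \<open>The records of HOL-Algebra monoids are reused; associativity is not assumed.\<close>

locale unitary_magma =
  fixes M (structure)
  assumes m_closed: "\<lbrakk>x \<in> carrier M; y \<in> carrier M\<rbrakk> \<Longrightarrow> x \<otimes> y \<in> carrier M"
    and one_closed: "\<one> \<in> carrier M"
    and l_one: "x \<in> carrier M \<Longrightarrow> \<one> \<otimes> x = x"
    and r_one: "x \<in> carrier M \<Longrightarrow> x \<otimes> \<one> = x"

definition unitary_magma_hom ::
  "('a, 'x) monoid_scheme \<Rightarrow> ('b, 'y) monoid_scheme \<Rightarrow> ('a \<Rightarrow> 'b) set" where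
  "unitary_magma_hom M N = {h \<in> hom M N. h \<one>\<^bsub>M\<^esub> = \<one>\<^bsub>N\<^esub>}"

definition rank_function :: "('a, 'x) monoid_scheme \<Rightarrow> ('a \<Rightarrow> int) \<Rightarrow> bool" where
  "rank_function M \<theta> \<longleftrightarrow> \<theta> \<in> unitary_magma_hom M integer_group"

locale int_graded_unitary_magma = unitary_magma +
  assumes ex_rank: "\<exists>\<theta>. rank_function M \<theta>"


section \<open>Nonsymmetric operads in vector spaces\<close>

text \<open>
  The space of arity \<open>n\<close> is a linear subspace \<open>op_space n\<close> of an ambient vector space. As these
  subspaces may overlap, the arities are arguments of the partial compositions:
  \<open>op_comp n m i x y\<close> is \<open>x \<circ>\<^sub>i y\<close> for \<open>x\<close> of arity \<open>n\<close> and \<open>y\<close> of arity \<open>m\<close>.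
  Only arities at least 1 are considered.
\<close>

record ('k, 'a) operad_struct =
  op_scale :: "'k \<Rightarrow> 'a \<Rightarrow> 'a"
  op_space :: "nat \<Rightarrow> 'a set"
  op_one :: 'a
  op_comp :: "nat \<Rightarrow> nat \<Rightarrow> nat \<Rightarrow> 'a \<Rightarrow> 'a \<Rightarrow> 'a"

locale operad =
  fixes P :: "('k::field, 'a::ab_group_add) operad_struct"
  assumes vector_space: "vector_space (op_scale P)"
    and subspace: "n \<ge> 1 \<Longrightarrow> module.subspace (op_scale P) (op_space P n)"
    and one_closed: "op_one P \<in> op_space P 1"
    and comp_closed:
      "\<lbrakk>x \<in> op_space P n; y \<in> op_space P m; m \<ge> 1; i \<in> {1..n}\<rbrakk>
        \<Longrightarrow> op_comp P n m i x y \<in> op_space P (n + m - 1)"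
    and comp_add_left:
      "\<lbrakk>x \<in> op_space P n; x' \<in> op_space P n; y \<in> op_space P m; m \<ge> 1; i \<in> {1..n}\<rbrakk>
        \<Longrightarrow> op_comp P n m i (x + x') y = op_comp P n m i x y + op_comp P n m i x' y"
    and comp_add_right:
      "\<lbrakk>x \<in> op_space P n; y \<in> op_space P m; y' \<in> op_space P m; m \<ge> 1; i \<in> {1..n}\<rbrakk>
        \<Longrightarrow> op_comp P n m i x (y + y') = op_comp P n m i x y + op_comp P n m i x y'"
    and comp_scale_left:
      "\<lbrakk>x \<in> op_space P n; y \<in> op_space P m; m \<ge> 1; i \<in> {1..n}\<rbrakk>
        \<Longrightarrow> op_comp P n m i (op_scale P c x) y = op_scale P c (op_comp P n m i x y)"
    and comp_scale_right:
      "\<lbrakk>x \<in> op_space P n; y \<in> op_space P m; m \<ge> 1; i \<in> {1..n}\<rbrakk>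
        \<Longrightarrow> op_comp P n m i x (op_scale P c y) = op_scale P c (op_comp P n m i x y)"
    and comp_sequential:
      "\<lbrakk>x \<in> op_space P n; y \<in> op_space P m; z \<in> op_space P l; l \<ge> 1; i \<in> {1..n}; j \<in> {1..m}\<rbrakk>
        \<Longrightarrow> op_comp P (n + m - 1) l (i + j - 1) (op_comp P n m i x y) z =
            op_comp P n (m + l - 1) i x (op_comp P m l j y z)"
    and comp_parallel:
      "\<lbrakk>x \<in> op_space P n; y \<in> op_space P m; z \<in> op_space P l; m \<ge> 1; l \<ge> 1;
        i \<in> {1..n}; j \<in> {1..n}; i < j\<rbrakk>
        \<Longrightarrow> op_comp P (n + m - 1) l (j + m - 1) (op_comp P n m i x y) z =
            op_comp P (n + l - 1) m i (op_comp P n l j x z) y"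
    and comp_one_left:
      "\<lbrakk>x \<in> op_space P n; n \<ge> 1\<rbrakk> \<Longrightarrow> op_comp P 1 n 1 (op_one P) x = x"
    and comp_one_right:
      "\<lbrakk>x \<in> op_space P n; i \<in> {1..n}\<rbrakk> \<Longrightarrow> op_comp P n 1 i x (op_one P) = x"

text \<open>An arity-preserving linear map is given by its components \<open>\<phi> n\<close>.\<close>

locale operad_morphism =
  source: operad P + target: operad Q
  for P :: "('k::field, 'a::ab_group_add) operad_struct"
    and Q :: "('k, 'b::ab_group_add) operad_struct" +
  fixes \<phi> :: "nat \<Rightarrow> 'a \<Rightarrow> 'b"
  assumes map_closed: "\<lbrakk>n \<ge> 1; x \<in> op_space P n\<rbrakk> \<Longrightarrow> \<phi> n x \<in> op_space Q n"
    and map_add: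
      "\<lbrakk>n \<ge> 1; x \<in> op_space P n; y \<in> op_space P n\<rbrakk> \<Longrightarrow> \<phi> n (x + y) = \<phi> n x + \<phi> n y"
    and map_scale:
      "\<lbrakk>n \<ge> 1; x \<in> op_space P n\<rbrakk> \<Longrightarrow> \<phi> n (op_scale P c x) = op_scale Q c (\<phi> n x)"
    and map_one: "\<phi> 1 (op_one P) = op_one Q"
    and map_comp:
      "\<lbrakk>x \<in> op_space P n; y \<in> op_space P m; m \<ge> 1; i \<in> {1..n}\<rbrakk>
        \<Longrightarrow> \<phi> (n + m - 1) (op_comp P n m i x y) = op_comp Q n m i (\<phi> n x) (\<phi> m y)"


section \<open>The operad of cliques\<close>

definition arcs :: "nat \<Rightarrow> (nat \<times> nat) set" where
  "arcs n = {(x, y). 1 \<le> x \<and> x < y \<and> y \<le> n + 1}"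

type_synonym 'm clique = "nat \<times> nat \<Rightarrow> 'm"

text \<open>By convention, the arc of a clique of arity 1 is labelled by the unit.\<close>

definition cliques :: "('m, 'x) monoid_scheme \<Rightarrow> nat \<Rightarrow> 'm clique set" where
  "cliques M n = {p \<in> arcs n \<rightarrow>\<^sub>E carrier M. n = 1 \<longrightarrow> p (1, 2) = \<one>\<^bsub>M\<^esub>}"

definition unit_clique :: "('m, 'x) monoid_scheme \<Rightarrow> 'm clique" where
  "unit_clique M = (\<lambda>a\<in>arcs 1. \<one>\<^bsub>M\<^esub>)"

definition clique_comp ::
  "('m, 'x) monoid_scheme \<Rightarrow> nat \<Rightarrow> nat \<Rightarrow> nat \<Rightarrow> 'm clique \<Rightarrow> 'm clique \<Rightarrow> 'm clique" where
  "clique_comp M n m i p q = (\<lambda>(x, y)\<in>arcs (n + m - 1).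
     if y \<le> i then p (x, y)
     else if x \<le> i \<and> i + m \<le> y \<and> (x, y) \<noteq> (i, i + m) then p (x, y - m + 1)
     else if i + m \<le> x then p (x - m + 1, y - m + 1)
     else if i \<le> x \<and> y \<le> i + m \<and> (x, y) \<noteq> (i, i + m) then q (x - i + 1, y - i + 1)
     else if (x, y) = (i, i + m) then p (i, i + 1) \<otimes>\<^bsub>M\<^esub> q (1, m + 1)
     else \<one>\<^bsub>M\<^esub>)"

text \<open>
  The free vector space on a set of cliques consists of the finitely supported functions
  whose support lies in that set; \<open>clique_operad M\<close> extends \<open>clique_comp\<close> bilinearly.
\<close>

definition clique_operad ::
  "('m, 'x) monoid_scheme \<Rightarrow> ('k::field, 'm clique \<Rightarrow>\<^sub>0 'k) operad_struct" where
  "clique_operad M = \<lparr>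
     op_scale = (\<lambda>c. Poly_Mapping.map ((*) c)),
     op_space = (\<lambda>n. {f. Poly_Mapping.keys f \<subseteq> cliques M n}),
     op_one = Poly_Mapping.single (unit_clique M) 1,
     op_comp = (\<lambda>n m i f g.
       \<Sum>p\<in>Poly_Mapping.keys f. \<Sum>q\<in>Poly_Mapping.keys g.
         Poly_Mapping.single (clique_comp M n m i p q)
           (Poly_Mapping.lookup f p * Poly_Mapping.lookup g q)) \<rparr>"


section \<open>The operad of rational functions\<close>

text \<open>
  Polynomials in the variables \<open>u\<^sub>0, u\<^sub>1, u\<^sub>2, \<dots>\<close>: a monomial is the finitely supported
  function giving the exponent of each variable. The field of rational functions in
  \<open>u\<^sub>1, \<dots>, u\<^sub>n\<close> is a subfield of the fraction field of this polynomial ring.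
\<close>

type_synonym 'k polynomial = "(nat \<Rightarrow>\<^sub>0 nat) \<Rightarrow>\<^sub>0 'k"

type_synonym 'k ratfun = "'k polynomial fract"

definition polynomial_vars :: "'k::zero polynomial \<Rightarrow> nat set" where
  "polynomial_vars p = (\<Union>t\<in>Poly_Mapping.keys p. Poly_Mapping.keys t)"

definition ratfuns :: "nat \<Rightarrow> 'k::field ratfun set" where
  "ratfuns n = {Fract p q | p q.
     q \<noteq> 0 \<and> polynomial_vars p \<subseteq> {1..n} \<and> polynomial_vars q \<subseteq> {1..n}}"

definition rat_const :: "'k::field \<Rightarrow> 'k ratfun" where
  "rat_const c = Fract (Poly_Mapping.single 0 c) 1"

definition rat_var :: "nat \<Rightarrow> 'k::field ratfun" where
  "rat_var v = Fract (Poly_Mapping.single (Poly_Mapping.single v 1) 1) 1"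

definition polynomial_subst :: "(nat \<Rightarrow> 'k::field ratfun) \<Rightarrow> 'k polynomial \<Rightarrow> 'k ratfun" where
  "polynomial_subst \<sigma> p = (\<Sum>t\<in>Poly_Mapping.keys p.
     rat_const (Poly_Mapping.lookup p t) *
     (\<Prod>v\<in>Poly_Mapping.keys t. \<sigma> v ^ Poly_Mapping.lookup t v))"

text \<open>
  Substitution of \<open>\<sigma> v\<close> for each variable \<open>u\<^sub>v\<close>. The value does not depend on the chosen
  representation of \<open>f\<close> as a quotient; it exists for all \<open>f\<close> if the \<open>\<sigma> v\<close> are algebraically
  independent, as they are in the two substitutions of \<open>rat_comp\<close>.
\<close>

definition rat_subst :: "(nat \<Rightarrow> 'k::field ratfun) \<Rightarrow> 'k ratfun \<Rightarrow> 'k ratfun" where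
  "rat_subst \<sigma> f = (THE r. \<exists>p q. f = Fract p q \<and> polynomial_subst \<sigma> q \<noteq> 0 \<and>
     r = polynomial_subst \<sigma> p / polynomial_subst \<sigma> q)"

definition rat_comp :: "nat \<Rightarrow> nat \<Rightarrow> 'k::field ratfun \<Rightarrow> 'k ratfun \<Rightarrow> 'k ratfun" where
  "rat_comp m i f g =
     rat_subst (\<lambda>k. if k < i then rat_var k
                    else if k = i then (\<Sum>j = i..i + m - 1. rat_var j)
                    else rat_var (k + m - 1)) f *
     rat_subst (\<lambda>k. rat_var (i + k - 1)) g"

definition rat_fct_operad :: "('k::field, 'k ratfun) operad_struct" where
  "rat_fct_operad = \<lparr>
     op_scale = (\<lambda>c f. rat_const c * f),
     op_space = ratfuns,
     op_one = 1,
     op_comp = (\<lambda>n. rat_comp) \<rparr>"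


section \<open>The map from cliques to rational functions\<close>

definition clique_ratfun :: "('m \<Rightarrow> int) \<Rightarrow> nat \<Rightarrow> 'm clique \<Rightarrow> 'k::field ratfun" where
  "clique_ratfun \<theta> n p =
     (\<Prod>(x, y)\<in>arcs n. (\<Sum>j = x..y - 1. rat_var j) powi \<theta> (p (x, y)))"

definition rank_map :: "('m \<Rightarrow> int) \<Rightarrow> nat \<Rightarrow> ('m clique \<Rightarrow>\<^sub>0 'k::field) \<Rightarrow> 'k ratfun" where
  "rank_map \<theta> n f = (\<Sum>p\<in>Poly_Mapping.keys f.
     rat_const (Poly_Mapping.lookup f p) * clique_ratfun \<theta> n p)"

end

theory Submission
  imports Defs
begin

text \<open>
  Write \<open>L(x, y) = u\<^sub>x + \<dots> + u\<^bsub>y - 1\<^esub>\<close> for the linear form of the arc \<open>(x, y)\<close>. A strictly monotone map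
  \<open>e\<close> of vertices induces a substitution \<open>u\<^sub>k \<mapsto> L(e k, e (k + 1))\<close>, which sends every \<open>L(x, y)\<close> with
  \<open>x \<le> y\<close> to \<open>L(e x, e y)\<close>, and substitutions compose as the maps of vertices do
  (\<open>rat_subst_linear_form\<close>, \<open>rat_subst_vertex_subst_comp\<close>). Both substitutions in the partial
  composition of rational functions are of this kind: the one for the outer operand comes from
  the renumbering of the vertices of a polygon when another polygon is glued to one of its edges, and
  the one for the inner operand from the renumbering of the glued polygon
  (\<open>rat_comp_vertex_subst\<close>).

  Hence \<open>f \<circ>\<^sub>i g\<close>, for \<open>f\<close> and \<open>g\<close> the images of cliques \<open>p\<close> and \<open>q\<close>, is the product of the powers
  of \<open>L(x, y)\<close> over the renumbered arcs of \<open>p\<close> and those of \<open>q\<close>. These are the arcs of \<open>p \<circ>\<^sub>i q\<close>,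
  except that arcs crossing the gluing edge \<open>(i, i + m)\<close> are missing, whose label is the unit, of
  rank 0, and that the gluing edge occurs twice, with ranks whose sum is the rank of the product of
  the two labels. So the map preserves partial compositions of cliques
  (\<open>clique_ratfun_comp\<close>), and by bilinearity all partial compositions.

  That the target is an operad reduces to identities between maps of vertices
  (\<open>rat_comp_sequential\<close>, \<open>rat_comp_parallel\<close>), once substitutions are known to be field
  homomorphisms. They are because the substituted families are algebraically independent
  (\<open>algebraically_independent_vertex_subst\<close>). That the source is an operad
  is checked on cliques by comparing the labels of each arc (\<open>clique_comp_sequential\<close>,
  \<open>clique_comp_parallel\<close>); associativity of the magma is not needed, because the arcs whose
  labels are multiplied in a double composition are different unless a clique of arity 1, labelled
  by the unit, lies in between.
\<close>

section \<open>Finitely supported functions\<close>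

lemma poly_mapping_sum_single:
  fixes f :: "'a \<Rightarrow>\<^sub>0 'b::comm_monoid_add"
  shows "f = (\<Sum>a\<in>Poly_Mapping.keys f. Poly_Mapping.single a (Poly_Mapping.lookup f a))"
  by (rule poly_mapping_eqI) (simp add: lookup_sum lookup_single when_def in_keys_iff)

lemma poly_mapping_induct_keys [consumes 1, case_names zero single add]:
  fixes f :: "'a \<Rightarrow>\<^sub>0 'b::comm_monoid_add"
  assumes "Poly_Mapping.keys f \<subseteq> A"
    and "P 0"
    and "\<And>a c. a \<in> A \<Longrightarrow> P (Poly_Mapping.single a c)"
    and "\<And>f g. P f \<Longrightarrow> P g \<Longrightarrow> P (f + g)"
  shows "P f"
proof -
  have "P (\<Sum>a\<in>B. Poly_Mapping.single a (Poly_Mapping.lookup f a))"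
    if "finite B" "B \<subseteq> A" for B
    using that by (induction B rule: finite_induct) (auto intro: assms(2-4))
  from this[OF finite_keys assms(1)] show ?thesis
    by (simp flip: poly_mapping_sum_single)
qed

lemma lookup_map_times [simp]:
  fixes c :: "'k::mult_zero"
  shows "Poly_Mapping.lookup (Poly_Mapping.map ((*) c) f) a = c * Poly_Mapping.lookup f a"
  by transfer (auto simp: when_def)


section \<open>Substitution in polynomials\<close>

lemma rat_const_0 [simp]: "rat_const 0 = 0"
  and rat_const_1 [simp]: "rat_const 1 = 1"
  by (simp_all add: rat_const_def Zero_fract_def One_fract_def)

lemma rat_const_add: "rat_const (a + b) = rat_const a + rat_const b"
  and rat_const_mult: "rat_const (a * b) = rat_const a * rat_const b"
  by (simp_all add: rat_const_def single_add mult_single)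

text \<open>The value of the monomial with exponents \<open>t\<close> under \<open>u\<^sub>v \<mapsto> \<sigma> v\<close>.\<close>

definition monomial_subst :: "(nat \<Rightarrow> 'k::field ratfun) \<Rightarrow> (nat \<Rightarrow>\<^sub>0 nat) \<Rightarrow> 'k ratfun" where
  "monomial_subst \<sigma> t = (\<Prod>v\<in>Poly_Mapping.keys t. \<sigma> v ^ Poly_Mapping.lookup t v)"

lemma monomial_subst_superset:
  assumes "finite S" "Poly_Mapping.keys t \<subseteq> S"
  shows "monomial_subst \<sigma> t = (\<Prod>v\<in>S. \<sigma> v ^ Poly_Mapping.lookup t v)"
  unfolding monomial_subst_def
  using assms by (intro prod.mono_neutral_left) (auto simp: in_keys_iff)

lemma monomial_subst_0 [simp]: "monomial_subst \<sigma> 0 = 1"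
  by (simp add: monomial_subst_def)

lemma monomial_subst_add: "monomial_subst \<sigma> (s + t) = monomial_subst \<sigma> s * monomial_subst \<sigma> t"
proof -
  define S where "S = Poly_Mapping.keys s \<union> Poly_Mapping.keys t"
  have "finite S" "Poly_Mapping.keys s \<subseteq> S" "Poly_Mapping.keys t \<subseteq> S"
    "Poly_Mapping.keys (s + t) \<subseteq> S"
    using keys_add[of s t] by (auto simp: S_def)
  then show ?thesis
    by (simp add: monomial_subst_superset[of S] lookup_add power_add prod.distrib)
qed

lemma polynomial_subst_monomials:
  "polynomial_subst \<sigma> p =
     (\<Sum>t\<in>Poly_Mapping.keys p. rat_const (Poly_Mapping.lookup p t) * monomial_subst \<sigma> t)"
  by (simp add: polynomial_subst_def monomial_subst_def)

lemma polynomial_subst_0 [simp]: "polynomial_subst \<sigma> 0 = 0"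
  by (simp add: polynomial_subst_def)

lemma polynomial_subst_single:
  "polynomial_subst \<sigma> (Poly_Mapping.single t c) = rat_const c * monomial_subst \<sigma> t"
  by (simp add: polynomial_subst_monomials)

lemma polynomial_subst_const [simp]: "polynomial_subst \<sigma> (Poly_Mapping.single 0 c) = rat_const c"
  by (simp add: polynomial_subst_single)

lemma polynomial_subst_1 [simp]: "polynomial_subst \<sigma> 1 = 1"
  using polynomial_subst_const[of \<sigma> 1] by simp

lemma polynomial_subst_var [simp]:
  "polynomial_subst \<sigma> (Poly_Mapping.single (Poly_Mapping.single v (Suc 0)) 1) = \<sigma> v"
  by (simp add: polynomial_subst_single monomial_subst_def)

lemma polynomial_subst_add:
  "polynomial_subst \<sigma> (p + q) = polynomial_subst \<sigma> p + polynomial_subst \<sigma> q"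
  unfolding polynomial_subst_monomials
  by (intro setsum_keys_plus_distrib) (simp_all add: rat_const_add distrib_right)

lemma polynomial_subst_sum:
  "polynomial_subst \<sigma> (\<Sum>x\<in>S. f x) = (\<Sum>x\<in>S. polynomial_subst \<sigma> (f x))"
  by (induction S rule: infinite_finite_induct) (simp_all add: polynomial_subst_add)

lemma polynomial_subst_mult:
  "polynomial_subst \<sigma> (p * q) = polynomial_subst \<sigma> p * polynomial_subst \<sigma> q"
proof -
  have "Poly_Mapping.keys p \<subseteq> UNIV" "Poly_Mapping.keys q \<subseteq> UNIV"
    by auto
  then show ?thesis
  proof (induction p rule: poly_mapping_induct_keys)
    case (single s a)
    from single(2) show ?case
      by (induction q rule: poly_mapping_induct_keys)
        (simp_all add: mult_single polynomial_subst_single rat_const_mult monomial_subst_add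
          distrib_left polynomial_subst_add)
  qed (simp_all add: distrib_right polynomial_subst_add)
qed

lemma polynomial_subst_cong:
  assumes "\<And>v. v \<in> polynomial_vars p \<Longrightarrow> \<sigma> v = \<tau> v"
  shows "polynomial_subst \<sigma> p = polynomial_subst \<tau> p"
  unfolding polynomial_subst_def
proof (intro sum.cong arg_cong2[where f="(*)"] prod.cong refl)
  fix t v
  assume "t \<in> Poly_Mapping.keys p" "v \<in> Poly_Mapping.keys t"
  then have "\<sigma> v = \<tau> v"
    by (intro assms) (auto simp: polynomial_vars_def)
  then show "\<sigma> v ^ Poly_Mapping.lookup t v = \<tau> v ^ Poly_Mapping.lookup t v"
    by simp
qed

lemma polynomial_induct [case_names const var add mult]:
  fixes p :: "'k::field polynomial"
  assumes const: "\<And>c. P (Poly_Mapping.single 0 c)"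
    and var: "\<And>v. P (Poly_Mapping.single (Poly_Mapping.single v 1) 1)"
    and add: "\<And>p q. P p \<Longrightarrow> P q \<Longrightarrow> P (p + q)"
    and mult: "\<And>p q. P p \<Longrightarrow> P q \<Longrightarrow> P (p * q)"
  shows "P p"
proof -
  have monomial: "P (Poly_Mapping.single t 1)" for t :: "nat \<Rightarrow>\<^sub>0 nat"
  proof -
    have "Poly_Mapping.keys t \<subseteq> UNIV"
      by simp
    then show ?thesis
    proof (induction t rule: poly_mapping_induct_keys)
      case (single v n)
      show ?case
      proof (induction n)
        case (Suc n)
        have "Poly_Mapping.single (Poly_Mapping.single v (Suc n)) (1::'k) =
          Poly_Mapping.single (Poly_Mapping.single v 1) 1 * Poly_Mapping.single (Poly_Mapping.single v n) 1"
          by (simp add: mult_single flip: single_add)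
        with mult[OF var Suc] show ?case
          by metis
      qed (use const[of 1] in simp)
    next
      case (add s t)
      then show ?case
        using mult[OF add] by (simp add: mult_single)
    qed (use const[of 1] in simp)
  qed
  have "Poly_Mapping.keys p \<subseteq> UNIV"
    by simp
  then show ?thesis
  proof (induction p rule: poly_mapping_induct_keys)
    case zero
    show ?case using const[of 0] by simp
  next
    case (single t c)
    show ?case
      using mult[OF const[of c] monomial[of t]] by (simp add: mult_single)
  qed (rule add)
qed


section \<open>Substitution in rational functions\<close>

text \<open>
  The values \<open>\<sigma> v\<close> are algebraically independent; this is what makes the substitution of
  \<open>\<sigma> v\<close> for \<open>u\<^sub>v\<close> defined on all rational functions.
\<close>

definition algebraically_independent :: "(nat \<Rightarrow> 'k::field ratfun) \<Rightarrow> bool" where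
  "algebraically_independent \<sigma> \<longleftrightarrow> (\<forall>p. p \<noteq> 0 \<longrightarrow> polynomial_subst \<sigma> p \<noteq> 0)"

text \<open>
  A family of polynomials is algebraically independent if a further substitution takes its
  members back to the variables.
\<close>

lemma algebraically_independent_retraction:
  fixes \<sigma> \<tau> :: "nat \<Rightarrow> 'k::field ratfun"
  assumes "\<And>v. \<exists>s. \<sigma> v = Fract s 1 \<and> polynomial_subst \<tau> s = rat_var v"
  shows "algebraically_independent \<sigma>"
  unfolding algebraically_independent_def
proof (intro allI impI)
  fix p :: "'k polynomial"
  assume "p \<noteq> 0"
  have "\<exists>s. polynomial_subst \<sigma> p = Fract s 1 \<and> polynomial_subst \<tau> s = Fract p 1"
  proof (induction p rule: polynomial_induct)
    case (const c)
    show ?case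
      by (rule exI[of _ "Poly_Mapping.single 0 c"]) (simp add: rat_const_def)
  next
    case (var v)
    show ?case
      using assms[of v] by (simp add: rat_var_def)
  next
    case (add p q)
    then obtain s t where
      "polynomial_subst \<sigma> p = Fract s 1" "polynomial_subst \<tau> s = Fract p 1"
      "polynomial_subst \<sigma> q = Fract t 1" "polynomial_subst \<tau> t = Fract q 1"
      by blast
    then show ?case
      by (intro exI[of _ "s + t"]) (simp add: polynomial_subst_add)
  next
    case (mult p q)
    then obtain s t where
      "polynomial_subst \<sigma> p = Fract s 1" "polynomial_subst \<tau> s = Fract p 1"
      "polynomial_subst \<sigma> q = Fract t 1" "polynomial_subst \<tau> t = Fract q 1"
      by blast
    then show ?case
      by (intro exI[of _ "s * t"]) (simp add: polynomial_subst_mult)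
  qed
  then obtain s where s: "polynomial_subst \<sigma> p = Fract s 1" "polynomial_subst \<tau> s = Fract p 1"
    by blast
  show "polynomial_subst \<sigma> p \<noteq> 0"
  proof
    assume "polynomial_subst \<sigma> p = 0"
    with s(1) have "s = 0"
      by (simp add: Zero_fract_def eq_fract)
    with s(2) \<open>p \<noteq> 0\<close> show False
      by (simp add: Zero_fract_def eq_fract)
  qed
qed

context
  fixes \<sigma> :: "nat \<Rightarrow> 'k::field ratfun"
  assumes indep: "algebraically_independent \<sigma>"
begin

lemma rat_subst_Fract:
  assumes "q \<noteq> 0"
  shows "rat_subst \<sigma> (Fract p q) = polynomial_subst \<sigma> p / polynomial_subst \<sigma> q"
  unfolding rat_subst_def
proof (rule the_equality)
  show "\<exists>p' q'. Fract p q = Fract p' q' \<and> polynomial_subst \<sigma> q' \<noteq> 0 \<and>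
      polynomial_subst \<sigma> p / polynomial_subst \<sigma> q =
      polynomial_subst \<sigma> p' / polynomial_subst \<sigma> q'"
    using indep assms by (auto simp: algebraically_independent_def)
next
  fix r
  assume "\<exists>p' q'. Fract p q = Fract p' q' \<and> polynomial_subst \<sigma> q' \<noteq> 0 \<and>
    r = polynomial_subst \<sigma> p' / polynomial_subst \<sigma> q'"
  then obtain p' q' where eq: "Fract p q = Fract p' q'"
    and nz: "polynomial_subst \<sigma> q' \<noteq> 0"
    and r: "r = polynomial_subst \<sigma> p' / polynomial_subst \<sigma> q'"
    by blast
  from nz have "q' \<noteq> 0"
    by auto
  with eq assms have "p * q' = p' * q"
    by (simp add: eq_fract)
  then have "polynomial_subst \<sigma> p * polynomial_subst \<sigma> q' =
      polynomial_subst \<sigma> p' * polynomial_subst \<sigma> q"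
    by (metis polynomial_subst_mult)
  moreover have "polynomial_subst \<sigma> q \<noteq> 0"
    using indep assms by (simp add: algebraically_independent_def)
  ultimately show "r = polynomial_subst \<sigma> p / polynomial_subst \<sigma> q"
    using nz by (simp add: r field_simps)
qed

lemma rat_subst_const [simp]: "rat_subst \<sigma> (rat_const c) = rat_const c"
  unfolding rat_const_def[of c] by (subst rat_subst_Fract) (simp_all, simp add: rat_const_def)

lemma rat_subst_var [simp]: "rat_subst \<sigma> (rat_var v) = \<sigma> v"
  unfolding rat_var_def by (subst rat_subst_Fract) simp_all

lemma rat_subst_0 [simp]: "rat_subst \<sigma> 0 = 0"
  using rat_subst_const[of 0] by simp

lemma rat_subst_1 [simp]: "rat_subst \<sigma> 1 = 1"
  using rat_subst_const[of 1] by simp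

lemma rat_subst_add: "rat_subst \<sigma> (f + g) = rat_subst \<sigma> f + rat_subst \<sigma> g"
proof -
  obtain p q where f: "f = Fract p q" "q \<noteq> 0" by (cases f)
  obtain p' q' where g: "g = Fract p' q'" "q' \<noteq> 0" by (cases g)
  have "polynomial_subst \<sigma> q \<noteq> 0" "polynomial_subst \<sigma> q' \<noteq> 0"
    using indep f g by (auto simp: algebraically_independent_def)
  with f g show ?thesis
    by (simp add: rat_subst_Fract polynomial_subst_add polynomial_subst_mult add_frac_eq)
qed

lemma rat_subst_mult: "rat_subst \<sigma> (f * g) = rat_subst \<sigma> f * rat_subst \<sigma> g"
proof -
  obtain p q where f: "f = Fract p q" "q \<noteq> 0" by (cases f)
  obtain p' q' where g: "g = Fract p' q'" "q' \<noteq> 0" by (cases g)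
  from f g show ?thesis
    by (simp add: rat_subst_Fract polynomial_subst_mult)
qed

lemma rat_subst_nonzero: "f \<noteq> 0 \<Longrightarrow> rat_subst \<sigma> f \<noteq> 0"
  using rat_subst_mult[of f "inverse f"] by force

lemma rat_subst_inverse: "rat_subst \<sigma> (inverse f) = inverse (rat_subst \<sigma> f)"
proof (cases "f = 0")
  case False
  then have "rat_subst \<sigma> f * rat_subst \<sigma> (inverse f) = 1"
    by (simp flip: rat_subst_mult)
  then show ?thesis
    by (metis inverse_unique)
qed simp

lemma rat_subst_power: "rat_subst \<sigma> (f ^ n) = rat_subst \<sigma> f ^ n"
  by (induction n) (simp_all add: rat_subst_mult)

lemma rat_subst_power_int: "rat_subst \<sigma> (f powi n) = rat_subst \<sigma> f powi n"
  by (simp add: power_int_def rat_subst_power rat_subst_inverse)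

lemma rat_subst_prod: "rat_subst \<sigma> (\<Prod>x\<in>S. h x) = (\<Prod>x\<in>S. rat_subst \<sigma> (h x))"
  by (induction S rule: infinite_finite_induct) (simp_all add: rat_subst_mult)

text \<open>
  A substitution composed with a substitution is a substitution, and algebraic independence is
  preserved because field homomorphisms are injective.
\<close>

lemma rat_subst_polynomial_subst:
  "rat_subst \<sigma> (polynomial_subst \<tau> p) = polynomial_subst (\<lambda>v. rat_subst \<sigma> (\<tau> v)) p"
  by (induction p rule: polynomial_induct)
    (simp_all add: polynomial_subst_add polynomial_subst_mult rat_subst_add rat_subst_mult)

lemma algebraically_independent_comp:
  "algebraically_independent \<tau> \<Longrightarrow> algebraically_independent (\<lambda>v. rat_subst \<sigma> (\<tau> v))"
  using rat_subst_nonzero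
  by (simp add: algebraically_independent_def flip: rat_subst_polynomial_subst)

end

lemma rat_subst_rat_subst:
  assumes "algebraically_independent \<sigma>" "algebraically_independent \<tau>"
  shows "rat_subst \<sigma> (rat_subst \<tau> f) = rat_subst (\<lambda>v. rat_subst \<sigma> (\<tau> v)) f"
proof -
  obtain p q where f: "f = Fract p q" "q \<noteq> 0" by (cases f)
  with assms show ?thesis
    by (simp add: rat_subst_Fract algebraically_independent_comp rat_subst_polynomial_subst
        rat_subst_mult rat_subst_inverse divide_inverse)
qed

lemma polynomial_subst_rat_var: "polynomial_subst rat_var p = Fract p 1"
  by (induction p rule: polynomial_induct)
    (simp_all add: polynomial_subst_add polynomial_subst_mult, simp_all add: rat_const_def rat_var_def)

lemma rat_subst_rat_var: "rat_subst rat_var f = f"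
proof -
  have "algebraically_independent (rat_var :: nat \<Rightarrow> 'a ratfun)"
    by (simp add: algebraically_independent_def polynomial_subst_rat_var Zero_fract_def eq_fract)
  moreover obtain p q where "f = Fract p q" "q \<noteq> 0" by (cases f)
  ultimately show ?thesis
    by (simp add: rat_subst_Fract polynomial_subst_rat_var)
qed


section \<open>The fields of rational functions\<close>

lemma polynomial_vars_const [simp]: "polynomial_vars (Poly_Mapping.single 0 c) = {}"
  and polynomial_vars_1 [simp]: "polynomial_vars 1 = {}"
  by (simp_all add: polynomial_vars_def)

lemma polynomial_vars_add: "polynomial_vars (p + q) \<subseteq> polynomial_vars p \<union> polynomial_vars q"
  using keys_add[of p q] by (fastforce simp: polynomial_vars_def)

lemma polynomial_vars_mult: "polynomial_vars (p * q) \<subseteq> polynomial_vars p \<union> polynomial_vars q"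
proof
  fix v
  assume "v \<in> polynomial_vars (p * q)"
  then obtain t where t: "t \<in> Poly_Mapping.keys (p * q)" "v \<in> Poly_Mapping.keys t"
    by (auto simp: polynomial_vars_def)
  from t(1) keys_mult[of p q] obtain a b where
    "t = a + b" "a \<in> Poly_Mapping.keys p" "b \<in> Poly_Mapping.keys q"
    by blast
  with t(2) keys_add[of a b] show "v \<in> polynomial_vars p \<union> polynomial_vars q"
    by (auto simp: polynomial_vars_def)
qed

lemma ratfunsE:
  assumes "f \<in> ratfuns n"
  obtains p q where "f = Fract p q" "q \<noteq> 0" "polynomial_vars p \<subseteq> {1..n}" "polynomial_vars q \<subseteq> {1..n}"
  using assms by (auto simp: ratfuns_def)

lemma ratfunsI:
  "q \<noteq> 0 \<Longrightarrow> polynomial_vars p \<subseteq> {1..n} \<Longrightarrow> polynomial_vars q \<subseteq> {1..n} \<Longrightarrow> Fract p q \<in> ratfuns n"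
  by (auto simp: ratfuns_def)

lemma rat_const_in_ratfuns [simp]: "rat_const c \<in> ratfuns n"
  unfolding rat_const_def by (rule ratfunsI) auto

lemma ratfuns_0 [simp]: "0 \<in> ratfuns n"
  using rat_const_in_ratfuns[of 0] by simp

lemma ratfuns_1 [simp]: "1 \<in> ratfuns n"
  using rat_const_in_ratfuns[of 1] by simp

lemma rat_var_in_ratfuns: "1 \<le> v \<Longrightarrow> v \<le> n \<Longrightarrow> rat_var v \<in> ratfuns n"
  unfolding rat_var_def by (rule ratfunsI) (auto simp: polynomial_vars_def)

lemma ratfuns_add:
  assumes "f \<in> ratfuns n" "g \<in> ratfuns n"
  shows "f + g \<in> ratfuns n"
proof -
  from assms obtain p q p' q' where
    f: "f = Fract p q" "q \<noteq> 0" "polynomial_vars p \<subseteq> {1..n}" "polynomial_vars q \<subseteq> {1..n}" and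
    g: "g = Fract p' q'" "q' \<noteq> 0" "polynomial_vars p' \<subseteq> {1..n}" "polynomial_vars q' \<subseteq> {1..n}"
    by (elim ratfunsE)
  have "f + g = Fract (p * q' + p' * q) (q * q')"
    using f g by simp
  also have "\<dots> \<in> ratfuns n"
    using f g
    by (intro ratfunsI no_zero_divisors order.trans[OF polynomial_vars_add]
        order.trans[OF polynomial_vars_mult] Un_least)
  finally show ?thesis .
qed

lemma ratfuns_mult:
  assumes "f \<in> ratfuns n" "g \<in> ratfuns n"
  shows "f * g \<in> ratfuns n"
proof -
  from assms obtain p q p' q' where
    f: "f = Fract p q" "q \<noteq> 0" "polynomial_vars p \<subseteq> {1..n}" "polynomial_vars q \<subseteq> {1..n}" and
    g: "g = Fract p' q'" "q' \<noteq> 0" "polynomial_vars p' \<subseteq> {1..n}" "polynomial_vars q' \<subseteq> {1..n}"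
    by (elim ratfunsE)
  have "f * g = Fract (p * p') (q * q')"
    using f g by simp
  also have "\<dots> \<in> ratfuns n"
    using f g
    by (intro ratfunsI no_zero_divisors order.trans[OF polynomial_vars_mult] Un_least)
  finally show ?thesis .
qed

lemma ratfuns_inverse:
  assumes "f \<in> ratfuns n"
  shows "inverse f \<in> ratfuns n"
proof -
  from assms obtain p q where
    f: "f = Fract p q" "q \<noteq> 0" "polynomial_vars p \<subseteq> {1..n}" "polynomial_vars q \<subseteq> {1..n}"
    by (elim ratfunsE)
  show ?thesis
  proof (cases "p = 0")
    case True
    with f have "f = 0"
      by (simp add: Zero_fract_def eq_fract)
    then show ?thesis
      by simp
  next
    case False
    with f show ?thesis
      by (simp add: ratfunsI)
  qed
qed

lemma ratfuns_power: "f \<in> ratfuns n \<Longrightarrow> f ^ k \<in> ratfuns n"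
  by (induction k) (simp_all add: ratfuns_mult)

lemma ratfuns_power_int: "f \<in> ratfuns n \<Longrightarrow> f powi k \<in> ratfuns n"
  by (simp add: power_int_def ratfuns_power ratfuns_inverse)

lemma ratfuns_sum: "(\<And>x. x \<in> S \<Longrightarrow> h x \<in> ratfuns n) \<Longrightarrow> (\<Sum>x\<in>S. h x) \<in> ratfuns n"
  by (induction S rule: infinite_finite_induct) (simp_all add: ratfuns_add)

lemma ratfuns_prod: "(\<And>x. x \<in> S \<Longrightarrow> h x \<in> ratfuns n) \<Longrightarrow> (\<Prod>x\<in>S. h x) \<in> ratfuns n"
  by (induction S rule: infinite_finite_induct) (simp_all add: ratfuns_mult)

lemma polynomial_subst_in_ratfuns:
  assumes "\<And>v. v \<in> polynomial_vars p \<Longrightarrow> \<sigma> v \<in> ratfuns n"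
  shows "polynomial_subst \<sigma> p \<in> ratfuns n"
  unfolding polynomial_subst_def
proof (intro ratfuns_sum ratfuns_mult rat_const_in_ratfuns ratfuns_prod ratfuns_power)
  fix t v
  assume "t \<in> Poly_Mapping.keys p" "v \<in> Poly_Mapping.keys t"
  then show "\<sigma> v \<in> ratfuns n"
    by (intro assms) (auto simp: polynomial_vars_def)
qed

lemma rat_subst_in_ratfuns:
  assumes "algebraically_independent \<sigma>" "f \<in> ratfuns n"
    and "\<And>v. v \<in> {1..n} \<Longrightarrow> \<sigma> v \<in> ratfuns n'"
  shows "rat_subst \<sigma> f \<in> ratfuns n'"
proof -
  from assms(2) obtain p q where
    f: "f = Fract p q" "q \<noteq> 0" "polynomial_vars p \<subseteq> {1..n}" "polynomial_vars q \<subseteq> {1..n}"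
    by (elim ratfunsE)
  then have "rat_subst \<sigma> f = polynomial_subst \<sigma> p * inverse (polynomial_subst \<sigma> q)"
    using assms(1) by (simp add: rat_subst_Fract divide_inverse)
  also have "\<dots> \<in> ratfuns n'"
    using f by (intro ratfuns_mult ratfuns_inverse polynomial_subst_in_ratfuns assms(3)) auto
  finally show ?thesis .
qed

lemma rat_subst_cong:
  assumes "algebraically_independent \<sigma>" "algebraically_independent \<tau>" "f \<in> ratfuns n"
    and "\<And>v. v \<in> {1..n} \<Longrightarrow> \<sigma> v = \<tau> v"
  shows "rat_subst \<sigma> f = rat_subst \<tau> f"
proof -
  from assms(3) obtain p q where
    f: "f = Fract p q" "q \<noteq> 0" "polynomial_vars p \<subseteq> {1..n}" "polynomial_vars q \<subseteq> {1..n}"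
    by (elim ratfunsE)
  then have "polynomial_subst \<sigma> p = polynomial_subst \<tau> p" "polynomial_subst \<sigma> q = polynomial_subst \<tau> q"
    by (auto intro!: polynomial_subst_cong assms(4))
  with f assms(1,2) show ?thesis
    by (simp add: rat_subst_Fract)
qed


section \<open>Substitutions given by maps of vertices\<close>

text \<open>The linear form of the arc \<open>(x, y)\<close>, that is, \<open>u\<^sub>x + \<dots> + u\<^bsub>y - 1\<^esub>\<close>.\<close>

definition linear_form :: "nat \<Rightarrow> nat \<Rightarrow> 'k::field ratfun" where
  "linear_form x y = (\<Sum>j = x..<y. rat_var j)"

text \<open>
  The variable \<open>u\<^sub>k\<close> is the linear form of the arc \<open>(k, k + 1)\<close>; a map \<open>e\<close> of vertices
  induces the substitution replacing it by the linear form of \<open>(e k, e (k + 1))\<close>.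
\<close>

definition vertex_subst :: "(nat \<Rightarrow> nat) \<Rightarrow> nat \<Rightarrow> 'k::field ratfun" where
  "vertex_subst e k = linear_form (e k) (e (Suc k))"

lemma linear_form_Suc [simp]: "linear_form k (Suc k) = rat_var k"
  by (simp add: linear_form_def)

lemma linear_form_add:
  "x \<le> y \<Longrightarrow> y \<le> z \<Longrightarrow> linear_form x y + linear_form y z = linear_form x z"
  by (simp add: linear_form_def sum.atLeastLessThan_concat)

lemma sum_rat_var: "(\<Sum>j\<in>S. rat_var j) =
    Fract (\<Sum>j\<in>S. Poly_Mapping.single (Poly_Mapping.single j 1) 1) 1"
  by (induction S rule: infinite_finite_induct) (simp_all add: rat_var_def Zero_fract_def)

lemma linear_form_nonzero:
  assumes "x < y"
  shows "linear_form x y \<noteq> (0 :: 'k::field ratfun)"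
proof
  let ?p = "\<Sum>j = x..<y. Poly_Mapping.single (Poly_Mapping.single j (1::nat)) (1::'k)"
  assume "linear_form x y = (0 :: 'k ratfun)"
  then have "?p = 0"
    unfolding linear_form_def sum_rat_var by (simp add: Zero_fract_def eq_fract)
  moreover have "Poly_Mapping.lookup ?p (Poly_Mapping.single x 1) = (\<Sum>j = x..<y. if j = x then 1 else 0)"
    unfolding lookup_sum
  proof (intro sum.cong refl)
    fix j
    have "Poly_Mapping.single j (1::nat) = Poly_Mapping.single x 1 \<longleftrightarrow> j = x"
      by (metis lookup_single_eq lookup_single_not_eq zero_neq_one)
    then show "Poly_Mapping.lookup (Poly_Mapping.single (Poly_Mapping.single j (1::nat)) (1::'k))
        (Poly_Mapping.single x 1) = (if j = x then 1 else 0)"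
      by (simp add: lookup_single when_def)
  qed
  ultimately show False
    using assms by simp
qed

lemma linear_form_in_ratfuns:
  assumes "1 \<le> x" "y \<le> n + 1"
  shows "linear_form x y \<in> ratfuns n"
  unfolding linear_form_def
  using assms by (intro ratfuns_sum rat_var_in_ratfuns) auto

text \<open>
  The retraction sends \<open>u\<^bsub>e k\<^esub>\<close> to \<open>u\<^sub>k\<close> and the variables outside the image of \<open>e\<close> to 0.
\<close>

lemma algebraically_independent_vertex_subst:
  assumes "strict_mono e"
  shows "algebraically_independent (vertex_subst e :: nat \<Rightarrow> 'k::field ratfun)"
proof (rule algebraically_independent_retraction)
  fix v
  define \<tau> :: "nat \<Rightarrow> 'k ratfun" where
    "\<tau> j = (if j \<in> range e then rat_var (the_inv e j) else 0)" for j
  let ?s = "\<Sum>j = e v..<e (Suc v). Poly_Mapping.single (Poly_Mapping.single j (1::nat)) (1::'k)"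
  have "j = e v" if "e v \<le> j" "j < e (Suc v)" "j \<in> range e" for j
    using that assms by (auto simp: strict_mono_less strict_mono_less_eq less_Suc_eq_le)
  then have "\<tau> j = (if j = e v then rat_var v else 0)" if "j \<in> {e v..<e (Suc v)}" for j
    using that strict_mono_imp_inj_on[OF assms] by (auto simp: \<tau>_def the_inv_f_f)
  then have "polynomial_subst \<tau> ?s = (\<Sum>j = e v..<e (Suc v). if j = e v then rat_var v else 0)"
    by (simp add: polynomial_subst_sum)
  also have "\<dots> = rat_var v"
    using assms by (simp add: strict_mono_less)
  finally have "polynomial_subst (\<lambda>j. if j \<in> range e then rat_var (the_inv e j) else 0) ?s = rat_var v"
    by (simp only: \<tau>_def[abs_def])
  moreover have "vertex_subst e v = (Fract ?s 1 :: 'k ratfun)"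
    by (simp add: vertex_subst_def linear_form_def sum_rat_var)
  ultimately show "\<exists>s. vertex_subst e v = (Fract s 1 :: 'k ratfun) \<and>
      polynomial_subst (\<lambda>j. if j \<in> range e then rat_var (the_inv e j) else 0) s = rat_var v"
    by blast
qed

lemma rat_subst_linear_form:
  assumes "strict_mono e" "x \<le> y"
  shows "rat_subst (vertex_subst e) (linear_form x y) = (linear_form (e x) (e y) :: 'k::field ratfun)"
  using assms(2)
proof (induction y rule: dec_induct)
  case base
  show ?case
    using assms(1) by (simp add: linear_form_def rat_subst_0 algebraically_independent_vertex_subst)
next
  case (step y)
  note indep = algebraically_independent_vertex_subst[OF assms(1)]
  have "linear_form x (Suc y) = linear_form x y + (rat_var y :: 'k ratfun)"
    using step(1) by (simp add: linear_form_def)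
  also have "rat_subst (vertex_subst e) \<dots> = linear_form (e x) (e y) + linear_form (e y) (e (Suc y))"
    using step(3) by (simp add: rat_subst_add[OF indep] rat_subst_var[OF indep] vertex_subst_def[of e y])
  also have "\<dots> = linear_form (e x) (e (Suc y))"
    using assms(1) step(1) by (intro linear_form_add) (simp_all add: strict_mono_less_eq)
  finally show ?case .
qed

lemma rat_subst_vertex_subst_comp:
  assumes "strict_mono d" "strict_mono e"
  shows "rat_subst (vertex_subst d) (rat_subst (vertex_subst e) (f :: 'k::field ratfun)) = rat_subst (vertex_subst (d \<circ> e)) f"
proof -
  have "rat_subst (vertex_subst d) (vertex_subst e v) = (vertex_subst (d \<circ> e) v :: 'k ratfun)" for v
    using assms unfolding vertex_subst_def
    by (simp add: rat_subst_linear_form[unfolded vertex_subst_def] strict_mono_less_eq)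
  then have "(\<lambda>v. rat_subst (vertex_subst d) (vertex_subst e v)) =
      (vertex_subst (d \<circ> e) :: nat \<Rightarrow> 'k ratfun)"
    by (rule ext)
  then show ?thesis
    using assms by (simp add: rat_subst_rat_subst algebraically_independent_vertex_subst)
qed

lemma rat_subst_vertex_subst_cong:
  assumes "strict_mono d" "strict_mono e" "f \<in> ratfuns n"
    and "\<And>x. 1 \<le> x \<Longrightarrow> x \<le> n + 1 \<Longrightarrow> d x = e x"
  shows "rat_subst (vertex_subst d) f = rat_subst (vertex_subst e) f"
  using assms
  by (intro rat_subst_cong[where n=n]) (auto simp: algebraically_independent_vertex_subst vertex_subst_def)

lemma rat_subst_vertex_subst_in_ratfuns:
  assumes "strict_mono e" "f \<in> ratfuns n"
    and "\<And>x. 1 \<le> x \<Longrightarrow> x \<le> n + 1 \<Longrightarrow> 1 \<le> e x \<and> e x \<le> n' + 1"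
  shows "rat_subst (vertex_subst e) f \<in> ratfuns n'"
proof (rule rat_subst_in_ratfuns[OF algebraically_independent_vertex_subst[OF assms(1)] assms(2)])
  fix v
  assume "v \<in> {1..n}"
  then show "vertex_subst e v \<in> ratfuns n'"
    unfolding vertex_subst_def
    using assms(3)[of v] assms(3)[of "Suc v"] by (intro linear_form_in_ratfuns) auto
qed

lemma rat_subst_vertex_subst_id: "rat_subst (vertex_subst (\<lambda>x. x)) f = f"
  by (simp add: vertex_subst_def[abs_def] rat_subst_rat_var)


section \<open>The operad of rational functions\<close>

text \<open>
  In a partial composition at \<open>i\<close>, the polygon of the inner operand, of arity \<open>m\<close>, is glued to
  the arc \<open>(i, i + 1)\<close> of the outer one. The vertices of the outer operand are renumbered by
  \<open>outer_vertex m i\<close>, and those of the inner operand by \<open>inner_vertex i\<close>.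
\<close>

definition outer_vertex :: "nat \<Rightarrow> nat \<Rightarrow> nat \<Rightarrow> nat" where
  "outer_vertex m i x = (if x \<le> i then x else x + m - 1)"

definition inner_vertex :: "nat \<Rightarrow> nat \<Rightarrow> nat" where
  "inner_vertex i x = x + i - 1"

lemma strict_mono_outer_vertex: "1 \<le> m \<Longrightarrow> strict_mono (outer_vertex m i)"
  by (auto simp: strict_mono_def outer_vertex_def)

lemma strict_mono_inner_vertex: "1 \<le> i \<Longrightarrow> strict_mono (inner_vertex i)"
  by (auto simp: strict_mono_def inner_vertex_def)

lemma rat_comp_vertex_subst:
  assumes "1 \<le> m" "1 \<le> i"
  shows "rat_comp m i f g =
    rat_subst (vertex_subst (outer_vertex m i)) f * rat_subst (vertex_subst (inner_vertex i)) g"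
proof -
  have "(\<lambda>k. if k < i then rat_var k else if k = i then (\<Sum>j = i..i + m - 1. rat_var j)
      else rat_var (k + m - 1)) = (vertex_subst (outer_vertex m i) :: nat \<Rightarrow> 'a ratfun)"
  proof
    fix k
    have "{i..i + m - 1} = {i..<i + m}"
      using assms by auto
    moreover have "linear_form i (i + m) = (\<Sum>j = i..<i + m. rat_var j :: 'a ratfun)"
      by (simp add: linear_form_def)
    moreover have "linear_form (k + m - 1) (k + m) = (rat_var (k + m - 1) :: 'a ratfun)"
      using assms linear_form_Suc[of "k + m - 1"] by simp
    ultimately show "(if k < i then rat_var k else if k = i then (\<Sum>j = i..i + m - 1. rat_var j)
        else rat_var (k + m - 1)) = (vertex_subst (outer_vertex m i) k :: 'a ratfun)"
      using assms by (auto simp: vertex_subst_def outer_vertex_def)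
  qed
  moreover have "(\<lambda>k. rat_var (i + k - 1)) = (vertex_subst (inner_vertex i) :: nat \<Rightarrow> 'a ratfun)"
  proof
    fix k
    have "Suc (k + i) - 1 = Suc (i + k - 1)" "k + i - 1 = i + k - 1"
      using assms by simp_all
    then show "rat_var (i + k - 1) = (vertex_subst (inner_vertex i) k :: 'a ratfun)"
      by (simp add: vertex_subst_def inner_vertex_def del: diff_Suc_1)
  qed
  ultimately show ?thesis
    by (simp add: rat_comp_def)
qed

lemma rat_subst_rat_comp:
  assumes "strict_mono e" "1 \<le> m" "1 \<le> i"
  shows "rat_subst (vertex_subst e) (rat_comp m i f g) =
    rat_subst (vertex_subst (e \<circ> outer_vertex m i)) f * rat_subst (vertex_subst (e \<circ> inner_vertex i)) g"
  using assms
  by (simp add: rat_comp_vertex_subst rat_subst_mult algebraically_independent_vertex_subst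
      rat_subst_vertex_subst_comp strict_mono_outer_vertex strict_mono_inner_vertex)

lemma rat_comp_add_left:
  assumes "1 \<le> m" "1 \<le> i"
  shows "rat_comp m i (f + f') g = rat_comp m i f g + rat_comp m i f' g"
  using assms
  by (simp add: rat_comp_vertex_subst rat_subst_add algebraically_independent_vertex_subst
      strict_mono_outer_vertex distrib_right)

lemma rat_comp_add_right:
  assumes "1 \<le> m" "1 \<le> i"
  shows "rat_comp m i f (g + g') = rat_comp m i f g + rat_comp m i f g'"
  using assms
  by (simp add: rat_comp_vertex_subst rat_subst_add algebraically_independent_vertex_subst
      strict_mono_inner_vertex distrib_left)

lemma rat_comp_scale_left:
  assumes "1 \<le> m" "1 \<le> i"
  shows "rat_comp m i (rat_const c * f) g = rat_const c * rat_comp m i f g"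
  using assms
  by (simp add: rat_comp_vertex_subst rat_subst_mult rat_subst_const algebraically_independent_vertex_subst
      strict_mono_outer_vertex mult.assoc)

lemma rat_comp_scale_right:
  assumes "1 \<le> m" "1 \<le> i"
  shows "rat_comp m i f (rat_const c * g) = rat_const c * rat_comp m i f g"
  using assms
  by (simp add: rat_comp_vertex_subst rat_subst_mult rat_subst_const algebraically_independent_vertex_subst
      strict_mono_inner_vertex mult.left_commute)

lemma rat_comp_in_ratfuns:
  assumes "f \<in> ratfuns n" "g \<in> ratfuns m" "1 \<le> m" "i \<in> {1..n}"
  shows "rat_comp m i f g \<in> ratfuns (n + m - 1)"
proof -
  have "rat_subst (vertex_subst (outer_vertex m i)) f \<in> ratfuns (n + m - 1)"
    using assms by (intro rat_subst_vertex_subst_in_ratfuns[where n=n] strict_mono_outer_vertex)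
      (auto simp: outer_vertex_def)
  moreover have "rat_subst (vertex_subst (inner_vertex i)) g \<in> ratfuns (n + m - 1)"
    using assms by (intro rat_subst_vertex_subst_in_ratfuns[where n=m] strict_mono_inner_vertex)
      (auto simp: inner_vertex_def)
  ultimately show ?thesis
    using assms by (simp add: rat_comp_vertex_subst ratfuns_mult)
qed

lemma rat_comp_sequential:
  assumes "1 \<le> m" "1 \<le> l" "1 \<le> i" "j \<in> {1..m}"
  shows "rat_comp l (i + j - 1) (rat_comp m i f g) h = rat_comp (m + l - 1) i f (rat_comp l j g h)"
proof -
  have "outer_vertex l (i + j - 1) \<circ> outer_vertex m i = outer_vertex (m + l - 1) i"
    "outer_vertex l (i + j - 1) \<circ> inner_vertex i = inner_vertex i \<circ> outer_vertex l j"
    "inner_vertex (i + j - 1) = inner_vertex i \<circ> inner_vertex j"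
    using assms by (auto simp: fun_eq_iff outer_vertex_def inner_vertex_def)
  moreover have "1 \<le> i + j - 1" "1 \<le> m + l - 1" "1 \<le> m" "1 \<le> j"
    using assms by auto
  ultimately show ?thesis
    using assms
    by (simp add: rat_comp_vertex_subst[of l "i + j - 1"] rat_comp_vertex_subst[of "m + l - 1"]
        rat_subst_rat_comp strict_mono_outer_vertex strict_mono_inner_vertex mult.assoc
        del: One_nat_def)
qed

lemma rat_comp_parallel:
  assumes "1 \<le> m" "1 \<le> l" "1 \<le> i" "i < j" "g \<in> ratfuns m" "h \<in> ratfuns l"
  shows "rat_comp l (j + m - 1) (rat_comp m i f g) h = rat_comp m i (rat_comp l j f h) g"
proof -
  have "outer_vertex l (j + m - 1) \<circ> outer_vertex m i = outer_vertex m i \<circ> outer_vertex l j"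
    using assms by (auto simp: fun_eq_iff outer_vertex_def)
  moreover have "rat_subst (vertex_subst (outer_vertex l (j + m - 1) \<circ> inner_vertex i)) g =
      rat_subst (vertex_subst (inner_vertex i)) g"
    using assms
    by (intro rat_subst_vertex_subst_cong[where n=m] strict_mono_o strict_mono_outer_vertex
        strict_mono_inner_vertex) (auto simp: outer_vertex_def inner_vertex_def)
  moreover have "rat_subst (vertex_subst (outer_vertex m i \<circ> inner_vertex j)) h =
      rat_subst (vertex_subst (inner_vertex (j + m - 1))) h"
    using assms
    by (intro rat_subst_vertex_subst_cong[where n=l] strict_mono_o strict_mono_outer_vertex
        strict_mono_inner_vertex) (auto simp: outer_vertex_def inner_vertex_def)
  ultimately show ?thesis
    using assms
    by (simp add: rat_comp_vertex_subst[of l "j + m - 1"] rat_comp_vertex_subst[of m i "rat_comp _ _ _ _"]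
        rat_subst_rat_comp strict_mono_outer_vertex strict_mono_inner_vertex mult_ac
        del: One_nat_def)
qed

lemma rat_comp_one_left: "rat_comp n 1 1 f = f" if "1 \<le> n"
proof -
  have "inner_vertex 1 = (\<lambda>x. x)"
    by (simp add: fun_eq_iff inner_vertex_def)
  with that show ?thesis
    by (simp add: rat_comp_vertex_subst rat_subst_vertex_subst_id rat_subst_1
        algebraically_independent_vertex_subst strict_mono_outer_vertex)
qed

lemma rat_comp_one_right: "rat_comp 1 i f 1 = f" if "1 \<le> i"
proof -
  have "outer_vertex 1 i = (\<lambda>x. x)"
    by (simp add: fun_eq_iff outer_vertex_def)
  with that show ?thesis
    by (simp add: rat_comp_vertex_subst rat_subst_vertex_subst_id rat_subst_1
        algebraically_independent_vertex_subst strict_mono_inner_vertex)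
qed

lemma vector_space_ratfun: "vector_space (\<lambda>c (f :: 'k::field ratfun). rat_const c * f)"
  by unfold_locales (simp_all add: rat_const_add rat_const_mult algebra_simps)

lemma operad_rat_fct: "operad (rat_fct_operad :: ('k::field, 'k ratfun) operad_struct)"
proof (rule operad.intro)
  show "vector_space (op_scale (rat_fct_operad :: ('k, 'k ratfun) operad_struct))"
    by (simp add: rat_fct_operad_def vector_space_ratfun)
next
  fix n :: nat
  interpret vector_space "\<lambda>c (f :: 'k ratfun). rat_const c * f"
    by (rule vector_space_ratfun)
  show "module.subspace (op_scale (rat_fct_operad :: ('k, 'k ratfun) operad_struct))
      (op_space rat_fct_operad n)"
    unfolding rat_fct_operad_def by (simp add: subspace_def ratfuns_add ratfuns_mult)
next
  fix n m l i j :: nat and f g h :: "'k ratfun"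
  assume "f \<in> op_space rat_fct_operad n" "g \<in> op_space rat_fct_operad m"
    "h \<in> op_space rat_fct_operad l" "m \<ge> 1" "l \<ge> 1" "i \<in> {1..n}" "j \<in> {1..n}" "i < j"
  then show "op_comp rat_fct_operad (n + m - 1) l (j + m - 1) (op_comp rat_fct_operad n m i f g) h =
      op_comp rat_fct_operad (n + l - 1) m i (op_comp rat_fct_operad n l j f h) g"
    using rat_comp_parallel[of m l i j g h f] by (simp add: rat_fct_operad_def)
next
  fix n m l i j :: nat and f g h :: "'k ratfun"
  assume "l \<ge> 1" "i \<in> {1..n}" "j \<in> {1..m}"
  then show "op_comp rat_fct_operad (n + m - 1) l (i + j - 1) (op_comp rat_fct_operad n m i f g) h =
      op_comp rat_fct_operad n (m + l - 1) i f (op_comp rat_fct_operad m l j g h)"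
    using rat_comp_sequential[of m l i j f g h] by (simp add: rat_fct_operad_def)
next
  fix n m i :: nat and f g :: "'k ratfun"
  assume "f \<in> op_space rat_fct_operad n" "g \<in> op_space rat_fct_operad m" "m \<ge> 1" "i \<in> {1..n}"
  then show "op_comp rat_fct_operad n m i f g \<in> op_space rat_fct_operad (n + m - 1)"
    using rat_comp_in_ratfuns[of f n g m i] by (simp add: rat_fct_operad_def)
qed (simp_all add: rat_fct_operad_def rat_comp_add_left rat_comp_add_right rat_comp_scale_left
    rat_comp_scale_right rat_comp_one_left rat_comp_one_right del: One_nat_def)


section \<open>The operad of cliques\<close>

lemma clique_comp_apply:
  "clique_comp M n m i p q (x, y) =
    (if 1 \<le> x \<and> x < y \<and> y \<le> n + m - 1 + 1 then
       if y \<le> i then p (x, y)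
       else if x \<le> i \<and> i + m \<le> y \<and> (x, y) \<noteq> (i, i + m) then p (x, y - m + 1)
       else if i + m \<le> x then p (x - m + 1, y - m + 1)
       else if i \<le> x \<and> y \<le> i + m \<and> (x, y) \<noteq> (i, i + m) then q (x - i + 1, y - i + 1)
       else if (x, y) = (i, i + m) then p (i, i + 1) \<otimes>\<^bsub>M\<^esub> q (1, m + 1)
       else \<one>\<^bsub>M\<^esub>
     else undefined)"
  by (simp add: clique_comp_def arcs_def)

text \<open>The same formula for \<open>i = a + 1\<close> and \<open>m = b + 1\<close>, with fewer truncated subtractions.\<close>

lemma clique_comp_Suc:
  "clique_comp M n (Suc b) (Suc a) p q (x, y) =
    (if 0 < x \<and> x < y \<and> y \<le> Suc (n + b) then
       if y \<le> Suc a then p (x, y)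
       else if a + b + 2 \<le> x then p (x - b, y - b)
       else if a < x \<and> y \<le> a + b + 2 then
         if x = Suc a \<and> y = a + b + 2 then p (Suc a, a + 2) \<otimes>\<^bsub>M\<^esub> q (1, b + 2) else q (x - a, y - a)
       else if x \<le> Suc a \<and> a + b + 2 \<le> y then p (x, y - b)
       else \<one>\<^bsub>M\<^esub>
     else undefined)"
  by (auto simp: clique_comp_apply Suc_diff_Suc)

lemma clique_comp_undefined:
  "\<not> (0 < x \<and> x < y \<and> y \<le> Suc (n + b)) \<Longrightarrow> clique_comp M n (Suc b) (Suc a) p q (x, y) = undefined"
  by (simp only: clique_comp_Suc if_False)

lemma clique_closed: "p \<in> cliques M n \<Longrightarrow> 1 \<le> x \<Longrightarrow> x < y \<Longrightarrow> y \<le> n + 1 \<Longrightarrow> p (x, y) \<in> carrier M"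
  by (auto simp: cliques_def arcs_def PiE_iff)

lemma clique_undefined: "p \<in> cliques M n \<Longrightarrow> \<not> (1 \<le> x \<and> x < y \<and> y \<le> n + 1) \<Longrightarrow> p (x, y) = undefined"
  by (auto simp: cliques_def arcs_def PiE_iff extensional_def)

lemma cliquesI:
  assumes "\<And>x y. 1 \<le> x \<Longrightarrow> x < y \<Longrightarrow> y \<le> n + 1 \<Longrightarrow> p (x, y) \<in> carrier M"
    and "\<And>x y. \<not> (1 \<le> x \<and> x < y \<and> y \<le> n + 1) \<Longrightarrow> p (x, y) = undefined"
    and "n = 1 \<Longrightarrow> p (1, 2) = \<one>\<^bsub>M\<^esub>"
  shows "p \<in> cliques M n"
  using assms by (auto simp: cliques_def arcs_def PiE_iff extensional_def)

lemma unit_clique_apply: "unit_clique M (x, y) = (if x = 1 \<and> y = 2 then \<one>\<^bsub>M\<^esub> else undefined)"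
  by (auto simp: unit_clique_def arcs_def)

context unitary_magma
begin

lemma unit_clique_in_cliques: "unit_clique M \<in> cliques M 1"
  by (rule cliquesI) (auto simp: unit_clique_apply one_closed)

lemma clique_comp_in_cliques:
  assumes p: "p \<in> cliques M n" and q: "q \<in> cliques M m" and "1 \<le> m" "i \<in> {1..n}"
  shows "clique_comp M n m i p q \<in> cliques M (n + m - 1)"
proof (rule cliquesI)
  fix x y
  assume "1 \<le> x" "x < y" "y \<le> n + m - 1 + 1"
  moreover obtain a b where Suc: "i = Suc a" "m = Suc b"
    using assms(3,4) by (cases i; cases m) auto
  moreover have "p (Suc a, a + 2) \<otimes> q (1, b + 2) \<in> carrier M"
    using assms(4) Suc by (intro m_closed clique_closed[OF p] clique_closed[OF q]) auto
  ultimately show "clique_comp M n m i p q (x, y) \<in> carrier M"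
    using assms(4) by (auto simp: clique_comp_Suc one_closed clique_closed[OF p] clique_closed[OF q])
next
  assume "n + m - 1 = 1"
  with assms(3,4) have [simp]: "n = 1" "m = 1" "i = 1"
    by auto
  have "p (1, 2) = \<one>" "q (1, 2) = \<one>"
    using p q by (simp_all add: cliques_def)
  then show "clique_comp M n m i p q (1, 2) = \<one>"
    by (simp add: clique_comp_apply l_one one_closed numeral_2_eq_2)
next
  fix x y
  assume "\<not> (1 \<le> x \<and> x < y \<and> y \<le> n + m - 1 + 1)"
  then show "clique_comp M n m i p q (x, y) = undefined"
    by (simp only: clique_comp_apply if_False)
qed

text \<open>
  Both sides have the same label at every arc. If \<open>q\<close> has arity 1, the gluing edges of the two
  compositions coincide, and its label \<open>\<one>\<close> makes the two bracketings of a triple product equal.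
\<close>

lemma clique_comp_sequential:
  assumes p: "p \<in> cliques M n" and q: "q \<in> cliques M m" and r: "r \<in> cliques M l"
    and "1 \<le> l" "i \<in> {1..n}" "j \<in> {1..m}"
  shows "clique_comp M (n + m - 1) l (i + j - 1) (clique_comp M n m i p q) r =
    clique_comp M n (m + l - 1) i p (clique_comp M m l j q r)"
proof (rule ext, clarify)
  fix x y
  obtain a b c d where Suc: "i = Suc a" "m = Suc b" "j = Suc c" "l = Suc d"
    using assms(4-6) by (cases i; cases m; cases j; cases l) auto
  have arity: "a < n" "c \<le> b"
    using assms(5,6) by (simp_all add: Suc)
  have units: "b = 0 \<Longrightarrow> q (Suc 0, Suc (Suc 0)) = \<one>" "p (Suc a, Suc (Suc a)) \<in> carrier M"
      "r (Suc 0, Suc (Suc d)) \<in> carrier M"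
    using q clique_closed[OF p, of "Suc a" "Suc (Suc a)"] clique_closed[OF r, of "Suc 0" "Suc (Suc d)"] arity
    by (auto simp: Suc cliques_def numeral_2_eq_2)
  have "clique_comp M (n + b) (Suc d) (Suc (a + c)) (clique_comp M n (Suc b) (Suc a) p q) r (x, y) =
    clique_comp M n (Suc (b + d)) (Suc a) p (clique_comp M (Suc b) (Suc d) (Suc c) q r) (x, y)"
  proof (cases "0 < x \<and> x < y \<and> y \<le> Suc (n + b + d)")
    case False
    then show ?thesis
      by (metis add.assoc clique_comp_undefined)
  next
    case valid: True
    \<comment> \<open>the position of the arc relative to the polygon obtained from \<open>q\<close> and \<open>r\<close>\<close>
    consider "y \<le> Suc a" | "a + b + d + 2 \<le> x"
      | "x \<le> Suc a" "y = a + b + d + 2" | "x \<le> Suc a" "a + b + d + 2 < y"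
      | "x < Suc a" "Suc a < y" "y < a + b + d + 2"
      | "Suc a < x" "x < a + b + d + 2" "a + b + d + 2 < y"
      | "a + 1 < x" "y \<le> a + b + d + 2" | "x = a + 1" "y < a + b + d + 2"
      using valid by atomize_elim linarith
    then show ?thesis
    proof cases
      case 1
      with valid arity units show ?thesis
        by (auto simp: clique_comp_Suc l_one r_one add_ac numeral_2_eq_2)
    next
      case 2
      with valid arity units show ?thesis
        by (auto simp: clique_comp_Suc l_one r_one add_ac numeral_2_eq_2)
    next
      case 3
      with valid arity units show ?thesis
        by (auto simp: clique_comp_Suc l_one r_one add_ac numeral_2_eq_2)
    next
      case 4
      with valid arity units show ?thesis
        by (auto simp: clique_comp_Suc l_one r_one add_ac numeral_2_eq_2)
    next
      case 5
      with valid arity units show ?thesis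
        by (auto simp: clique_comp_Suc l_one r_one add_ac numeral_2_eq_2)
    next
      case 6
      with valid arity units show ?thesis
        by (auto simp: clique_comp_Suc l_one r_one add_ac numeral_2_eq_2)
    next
      case inside: 7
      \<comment> \<open>the position of the arc relative to the polygon of \<open>r\<close>\<close>
      consider "y \<le> a + c + 1" | "a + c + d + 2 \<le> x"
        | "x \<le> a + c + 1" "a + c + 1 < y" "y < a + c + d + 2"
        | "a + c + 1 < x" "x < a + c + d + 2" "a + c + d + 2 \<le> y"
        | "a + c + 1 < x" "y < a + c + d + 2"
        | "x < a + c + 1" "a + c + d + 2 \<le> y"
        | "x = a + c + 1" "y = a + c + d + 2"
        | "x = a + c + 1" "a + c + d + 2 < y"
        by atomize_elim linarith
      then show ?thesis
      proof cases
        case 1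
        with inside valid arity units show ?thesis
          by (auto simp: clique_comp_Suc l_one r_one add_ac numeral_2_eq_2)
      next
        case 2
        with inside valid arity units show ?thesis
          by (auto simp: clique_comp_Suc l_one r_one add_ac numeral_2_eq_2)
      next
        case 3
        with inside valid arity units show ?thesis
          by (auto simp: clique_comp_Suc l_one r_one add_ac numeral_2_eq_2)
      next
        case 4
        with inside valid arity units show ?thesis
          by (auto simp: clique_comp_Suc l_one r_one add_ac numeral_2_eq_2)
      next
        case 5
        with inside valid arity units show ?thesis
          by (auto simp: clique_comp_Suc l_one r_one add_ac numeral_2_eq_2)
      next
        case 6
        with inside valid arity units show ?thesis
          by (auto simp: clique_comp_Suc l_one r_one add_ac numeral_2_eq_2)
      next
        case 7
        with inside valid arity units show ?thesis
          by (auto simp: clique_comp_Suc l_one r_one add_ac numeral_2_eq_2)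
      next
        case 8
        with inside valid arity units show ?thesis
          by (auto simp: clique_comp_Suc l_one r_one add_ac numeral_2_eq_2)
      qed
    next
      case left_end: 8
      \<comment> \<open>the arcs from the left end of that polygon, except its base; if \<open>c = 0\<close>, they may
        include the base of the polygon of \<open>r\<close>\<close>
      consider "y \<le> a + c + 1" | "a + c + 1 < y" "y < a + c + d + 2"
        | "0 < c" "a + c + d + 2 \<le> y" | "c = 0" "y = a + d + 2" | "c = 0" "a + d + 2 < y"
        by atomize_elim linarith
      then show ?thesis
      proof cases
        case 1
        with left_end valid arity units show ?thesis
          by (auto simp: clique_comp_Suc l_one r_one add_ac numeral_2_eq_2)
      next
        case 2
        with left_end valid arity units show ?thesis
          by (auto simp: clique_comp_Suc l_one r_one add_ac numeral_2_eq_2)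
      next
        case 3
        with left_end valid arity units show ?thesis
          by (auto simp: clique_comp_Suc l_one r_one add_ac numeral_2_eq_2)
      next
        case 4
        with left_end valid arity units show ?thesis
          by (auto simp: clique_comp_Suc l_one r_one add_ac numeral_2_eq_2)
      next
        case 5
        with left_end valid arity units show ?thesis
          by (auto simp: clique_comp_Suc l_one r_one add_ac numeral_2_eq_2)
      qed
    qed
  qed
  then show "clique_comp M (n + m - 1) l (i + j - 1) (clique_comp M n m i p q) r (x, y) =
      clique_comp M n (m + l - 1) i p (clique_comp M m l j q r) (x, y)"
    by (simp add: Suc)
qed

lemma clique_comp_parallel:
  assumes "1 \<le> m" "1 \<le> l" "i \<in> {1..n}" "j \<in> {1..n}" "i < j"
  shows "clique_comp M (n + m - 1) l (j + m - 1) (clique_comp M n m i p q) r =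
    clique_comp M (n + l - 1) m i (clique_comp M n l j p r) q"
proof (rule ext, clarify)
  fix x y
  obtain a b c d where Suc: "i = Suc a" "m = Suc b" "j = Suc c" "l = Suc d"
    using assms by (cases i; cases m; cases j; cases l) auto
  have arity: "c < n" "a < c"
    using assms by (simp_all add: Suc)
  have "clique_comp M (n + b) (Suc d) (Suc (c + b)) (clique_comp M n (Suc b) (Suc a) p q) r (x, y) =
    clique_comp M (n + d) (Suc b) (Suc a) (clique_comp M n (Suc d) (Suc c) p r) q (x, y)"
  proof (cases "0 < x \<and> x < y \<and> y \<le> Suc (n + b + d)")
    case False
    then show ?thesis
      by (metis add.assoc add.commute clique_comp_undefined)
  next
    case valid: True
    \<comment> \<open>the position of the arc relative to the polygon of \<open>q\<close>\<close>
    consider "y \<le> Suc a" | "x < Suc a" "Suc a < y" "y < a + b + 2" | "a < x" "y \<le> a + b + 2"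
      | "a + 1 < x" "x < a + b + 2" "a + b + 2 < y"
      | "x \<le> a + 1" "a + b + 2 \<le> y" | "a + b + 2 \<le> x"
      using valid by atomize_elim linarith
    then show ?thesis
    proof cases
      case 1
      with valid arity show ?thesis
        by (auto simp: clique_comp_Suc add_ac)
    next
      case 2
      with valid arity show ?thesis
        by (auto simp: clique_comp_Suc add_ac)
    next
      case 3
      with valid arity show ?thesis
        by (auto simp: clique_comp_Suc add_ac)
    next
      case 4
      with valid arity show ?thesis
        by (auto simp: clique_comp_Suc add_ac)
    next
      case over: 5
      consider "y \<le> c + b + 1" | "c + b + 1 < y" "y < c + b + d + 2"
        | "c + b + d + 2 = y" | "c + b + d + 2 < y"
        by atomize_elim linarith
      then show ?thesis
      proof cases
        case 1
        with over valid arity show ?thesis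
          by (auto simp: clique_comp_Suc add_ac)
      next
        case 2
        with over valid arity show ?thesis
          by (auto simp: clique_comp_Suc add_ac)
      next
        case 3
        with over valid arity show ?thesis
          by (auto simp: clique_comp_Suc add_ac)
      next
        case 4
        with over valid arity show ?thesis
          by (auto simp: clique_comp_Suc add_ac)
      qed
    next
      case right: 6
      \<comment> \<open>the position of the arc relative to the polygon of \<open>r\<close>\<close>
      consider "y \<le> c + b + 1" | "x \<le> c + b" "c + b + 1 < y" "y < c + b + d + 2"
        | "x \<le> c + b + 1" "c + b + d + 2 \<le> y"
        | "c + b + 1 \<le> x" "y < c + b + d + 2" | "c + b + 1 < x" "y = c + b + d + 2"
        | "c + b + 1 < x" "x < c + b + d + 2" "c + b + d + 2 < y"
        | "c + b + d + 2 \<le> x"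
        using valid by atomize_elim linarith
      then show ?thesis
      proof cases
        case 1
        with right valid arity show ?thesis
          by (auto simp: clique_comp_Suc add_ac)
      next
        case 2
        with right valid arity show ?thesis
          by (auto simp: clique_comp_Suc add_ac)
      next
        case 3
        with right valid arity show ?thesis
          by (auto simp: clique_comp_Suc add_ac)
      next
        case 4
        with right valid arity show ?thesis
          by (auto simp: clique_comp_Suc add_ac)
      next
        case 5
        with right valid arity show ?thesis
          by (auto simp: clique_comp_Suc add_ac)
      next
        case 6
        with right valid arity show ?thesis
          by (auto simp: clique_comp_Suc add_ac)
      next
        case 7
        with right valid arity show ?thesis
          by (auto simp: clique_comp_Suc add_ac)
      qed
    qed
  qed
  then show "clique_comp M (n + m - 1) l (j + m - 1) (clique_comp M n m i p q) r (x, y) =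
      clique_comp M (n + l - 1) m i (clique_comp M n l j p r) q (x, y)"
    by (simp add: Suc)
qed

lemma clique_comp_one_left:
  assumes p: "p \<in> cliques M n" and "1 \<le> n"
  shows "clique_comp M 1 n 1 (unit_clique M) p = p"
proof (rule ext, clarify)
  fix x y
  show "clique_comp M 1 n 1 (unit_clique M) p (x, y) = p (x, y)"
    using assms clique_undefined[OF p, of x y] clique_closed[OF p, of 1 "n + 1"]
    by (auto simp: clique_comp_apply unit_clique_apply l_one)
qed

lemma clique_comp_one_right:
  assumes p: "p \<in> cliques M n" and "i \<in> {1..n}"
  shows "clique_comp M n 1 i p (unit_clique M) = p"
proof (rule ext, clarify)
  fix x y
  show "clique_comp M n 1 i p (unit_clique M) (x, y) = p (x, y)"
    using assms clique_undefined[OF p, of x y] clique_closed[OF p, of i "i + 1"]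
    by (auto simp: clique_comp_apply unit_clique_apply r_one)
qed

end


subsection \<open>Bilinear extension\<close>

text \<open>The bilinear extension of the partial composition of cliques.\<close>

definition clique_op_comp ::
  "('m, 'x) monoid_scheme \<Rightarrow> nat \<Rightarrow> nat \<Rightarrow> nat \<Rightarrow>
    ('m clique \<Rightarrow>\<^sub>0 'k::field) \<Rightarrow> ('m clique \<Rightarrow>\<^sub>0 'k) \<Rightarrow> 'm clique \<Rightarrow>\<^sub>0 'k" where
  "clique_op_comp M n m i f g =
    (\<Sum>p\<in>Poly_Mapping.keys f. \<Sum>q\<in>Poly_Mapping.keys g.
      Poly_Mapping.single (clique_comp M n m i p q) (Poly_Mapping.lookup f p * Poly_Mapping.lookup g q))"

lemma clique_op_comp_0 [simp]:
  "clique_op_comp M n m i 0 g = 0" "clique_op_comp M n m i f 0 = 0"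
  by (simp_all add: clique_op_comp_def)

lemma clique_op_comp_single [simp]:
  "clique_op_comp M n m i (Poly_Mapping.single p a) (Poly_Mapping.single q b) =
    Poly_Mapping.single (clique_comp M n m i p q) (a * b)"
  by (simp add: clique_op_comp_def)

lemma clique_op_comp_add_left:
  "clique_op_comp M n m i (f + f') g = clique_op_comp M n m i f g + clique_op_comp M n m i f' g"
  unfolding clique_op_comp_def
  by (intro setsum_keys_plus_distrib) (simp_all add: distrib_right single_add sum.distrib)

lemma clique_op_comp_add_right:
  "clique_op_comp M n m i f (g + g') = clique_op_comp M n m i f g + clique_op_comp M n m i f g'"
proof -
  have "(\<Sum>q\<in>Poly_Mapping.keys (g + g'). Poly_Mapping.single (clique_comp M n m i p q)
        (Poly_Mapping.lookup f p * Poly_Mapping.lookup (g + g') q)) =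
      (\<Sum>q\<in>Poly_Mapping.keys g. Poly_Mapping.single (clique_comp M n m i p q)
        (Poly_Mapping.lookup f p * Poly_Mapping.lookup g q)) +
      (\<Sum>q\<in>Poly_Mapping.keys g'. Poly_Mapping.single (clique_comp M n m i p q)
        (Poly_Mapping.lookup f p * Poly_Mapping.lookup g' q))" for p
    by (intro setsum_keys_plus_distrib) (simp_all add: distrib_left single_add)
  then show ?thesis
    by (simp add: clique_op_comp_def sum.distrib)
qed

lemma map_times_add:
  fixes c :: "'k::field"
  shows "Poly_Mapping.map ((*) c) (f + g) = Poly_Mapping.map ((*) c) f + Poly_Mapping.map ((*) c) g"
  by (rule poly_mapping_eqI) (simp add: lookup_add distrib_left)

lemma map_times_single:
  fixes c :: "'k::field"
  shows "Poly_Mapping.map ((*) c) (Poly_Mapping.single a b) = Poly_Mapping.single a (c * b)"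
  by (rule poly_mapping_eqI) (simp add: lookup_single when_def)

lemma map_times_0 [simp]:
  fixes c :: "'k::field"
  shows "Poly_Mapping.map ((*) c) 0 = 0"
  by (rule poly_mapping_eqI) simp

lemma clique_op_comp_scale_left:
  "clique_op_comp M n m i (Poly_Mapping.map ((*) c) f) g =
    Poly_Mapping.map ((*) c) (clique_op_comp M n m i f g)"
  using subset_UNIV
proof (induction f rule: poly_mapping_induct_keys)
  case (single p a)
  show ?case
    using subset_UNIV
    by (induction g rule: poly_mapping_induct_keys)
      (simp_all add: clique_op_comp_add_right map_times_add map_times_single mult.assoc)
qed (simp_all add: clique_op_comp_add_left map_times_add)

lemma clique_op_comp_scale_right:
  "clique_op_comp M n m i f (Poly_Mapping.map ((*) c) g) =
    Poly_Mapping.map ((*) c) (clique_op_comp M n m i f g)"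
  using subset_UNIV
proof (induction f rule: poly_mapping_induct_keys)
  case (single p a)
  show ?case
    using subset_UNIV
    by (induction g rule: poly_mapping_induct_keys)
      (simp_all add: clique_op_comp_add_right map_times_add map_times_single mult.left_commute)
qed (simp_all add: clique_op_comp_add_left map_times_add)

lemma clique_operad_simps:
  "op_scale (clique_operad M) = (\<lambda>c. Poly_Mapping.map ((*) c))"
  "op_space (clique_operad M) n = {f. Poly_Mapping.keys f \<subseteq> cliques M n}"
  "op_one (clique_operad M) = Poly_Mapping.single (unit_clique M) 1"
  "op_comp (clique_operad M) = clique_op_comp M"
  by (simp_all add: clique_operad_def clique_op_comp_def fun_eq_iff)

lemma vector_space_map_times:
  "vector_space (\<lambda>c :: 'k::field. Poly_Mapping.map ((*) c) :: ('a \<Rightarrow>\<^sub>0 'k) \<Rightarrow> 'a \<Rightarrow>\<^sub>0 'k)"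
  by unfold_locales (auto intro!: poly_mapping_eqI simp: lookup_add algebra_simps)

context unitary_magma
begin

lemma clique_op_comp_closed:
  assumes "Poly_Mapping.keys f \<subseteq> cliques M n" "Poly_Mapping.keys g \<subseteq> cliques M m" "1 \<le> m" "i \<in> {1..n}"
  shows "Poly_Mapping.keys (clique_op_comp M n m i f g) \<subseteq> cliques M (n + m - 1)"
  using assms(1)
proof (induction f rule: poly_mapping_induct_keys)
  case (single p a)
  show ?case
    using assms(2)
  proof (induction g rule: poly_mapping_induct_keys)
    case (single q b)
    then show ?case
      using \<open>p \<in> cliques M n\<close> assms(3,4) clique_comp_in_cliques[of p n q m i] by simp
  next
    case (add g g')
    then show ?case
      unfolding clique_op_comp_add_right by (intro order.trans[OF keys_add] Un_least)
  qed simp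
next
  case (add f f')
  then show ?case
    unfolding clique_op_comp_add_left by (intro order.trans[OF keys_add] Un_least)
qed simp

lemma clique_op_comp_sequential:
  assumes f: "Poly_Mapping.keys f \<subseteq> cliques M n" and g: "Poly_Mapping.keys g \<subseteq> cliques M m"
    and h: "Poly_Mapping.keys h \<subseteq> cliques M l" and arity: "1 \<le> l" "i \<in> {1..n}" "j \<in> {1..m}"
  shows "clique_op_comp M (n + m - 1) l (i + j - 1) (clique_op_comp M n m i f g) h =
    clique_op_comp M n (m + l - 1) i f (clique_op_comp M m l j g h)"
  using f
proof (induction f rule: poly_mapping_induct_keys)
  case p: (single p a)
  show ?case
    using g
  proof (induction g rule: poly_mapping_induct_keys)
    case q: (single q b)
    show ?case
      using h
    proof (induction h rule: poly_mapping_induct_keys)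
      case r: (single r c)
      show ?case
        using clique_comp_sequential[OF p q r arity] by (simp add: mult.assoc)
    qed (simp_all add: clique_op_comp_add_right)
  qed (simp_all add: clique_op_comp_add_left clique_op_comp_add_right)
qed (simp_all add: clique_op_comp_add_left)

lemma clique_op_comp_parallel:
  assumes arity: "1 \<le> m" "1 \<le> l" "i \<in> {1..n}" "j \<in> {1..n}" "i < j"
  shows "clique_op_comp M (n + m - 1) l (j + m - 1) (clique_op_comp M n m i f g) h =
    clique_op_comp M (n + l - 1) m i (clique_op_comp M n l j f h) g"
  using subset_UNIV
proof (induction f rule: poly_mapping_induct_keys)
  case (single p a)
  show ?case
    using subset_UNIV
  proof (induction g rule: poly_mapping_induct_keys)
    case (single q b)
    show ?case
      using subset_UNIV
    proof (induction h rule: poly_mapping_induct_keys)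
      case (single r c)
      show ?case
        using clique_comp_parallel[OF arity, of p q r] by (simp add: mult_ac)
    qed (simp_all add: clique_op_comp_add_left clique_op_comp_add_right)
  qed (simp_all add: clique_op_comp_add_left clique_op_comp_add_right)
qed (simp_all add: clique_op_comp_add_left)

lemma clique_op_comp_one_left:
  assumes "Poly_Mapping.keys f \<subseteq> cliques M n" "1 \<le> n"
  shows "clique_op_comp M 1 n 1 (Poly_Mapping.single (unit_clique M) 1) f = f"
  using assms(1)
  by (induction f rule: poly_mapping_induct_keys)
    (simp_all add: clique_op_comp_add_right clique_comp_one_left assms(2) del: One_nat_def)

lemma clique_op_comp_one_right:
  assumes "Poly_Mapping.keys f \<subseteq> cliques M n" "i \<in> {1..n}"
  shows "clique_op_comp M n 1 i f (Poly_Mapping.single (unit_clique M) 1) = f"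
  using assms(1)
  by (induction f rule: poly_mapping_induct_keys)
    (simp_all add: clique_op_comp_add_left clique_comp_one_right[OF _ assms(2)] del: One_nat_def)

lemma operad_clique: "operad (clique_operad M :: ('k::field, 'a clique \<Rightarrow>\<^sub>0 'k) operad_struct)"
proof (rule operad.intro, unfold clique_operad_simps mem_Collect_eq)
  show "vector_space (\<lambda>c :: 'k. Poly_Mapping.map ((*) c) :: ('a clique \<Rightarrow>\<^sub>0 'k) \<Rightarrow> _)"
    by (rule vector_space_map_times)
next
  fix n :: nat
  interpret vector_space "\<lambda>c :: 'k. Poly_Mapping.map ((*) c) :: ('a clique \<Rightarrow>\<^sub>0 'k) \<Rightarrow> _"
    by (rule vector_space_map_times)
  have "Poly_Mapping.keys (Poly_Mapping.map ((*) c) f) \<subseteq> Poly_Mapping.keys f"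
    for c and f :: "'a clique \<Rightarrow>\<^sub>0 'k"
    by (auto simp: in_keys_iff)
  then show "module.subspace (\<lambda>c :: 'k. Poly_Mapping.map ((*) c))
      {f :: 'a clique \<Rightarrow>\<^sub>0 'k. Poly_Mapping.keys f \<subseteq> cliques M n}"
    by (simp add: subspace_def subset_trans[OF keys_add Un_least]) (meson subset_trans)
next
  show "Poly_Mapping.keys (Poly_Mapping.single (unit_clique M) (1 :: 'k)) \<subseteq> cliques M 1"
    by (simp add: unit_clique_in_cliques del: One_nat_def)
qed (rule clique_op_comp_closed clique_op_comp_add_left clique_op_comp_add_right
    clique_op_comp_scale_left clique_op_comp_scale_right clique_op_comp_sequential
    clique_op_comp_parallel clique_op_comp_one_left clique_op_comp_one_right; assumption)+

end


section \<open>The morphism\<close>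

lemma clique_ratfun_linear_form:
  "clique_ratfun \<theta> n p = (\<Prod>(x, y)\<in>arcs n. linear_form x y powi \<theta> (p (x, y)))"
proof -
  have "{x..y - 1} = {x..<y}" if "(x, y) \<in> arcs n" for x y
    using that by (auto simp: arcs_def)
  then show ?thesis
    unfolding clique_ratfun_def linear_form_def by (intro prod.cong) auto
qed

lemma finite_arcs [simp]: "finite (arcs n)"
  by (rule finite_subset[of _ "{..n + 1} \<times> {..n + 1}"]) (auto simp: arcs_def)

lemma clique_ratfun_in_ratfuns: "clique_ratfun \<theta> n p \<in> ratfuns n"
  unfolding clique_ratfun_linear_form
  by (intro ratfuns_prod) (auto simp: arcs_def intro!: ratfuns_power_int linear_form_in_ratfuns)

lemma rat_subst_clique_ratfun:
  assumes "strict_mono e"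
  shows "rat_subst (vertex_subst e) (clique_ratfun \<theta> n p) =
    (\<Prod>(x, y)\<in>arcs n. linear_form (e x) (e y) powi \<theta> (p (x, y)))"
proof -
  note indep = algebraically_independent_vertex_subst[OF assms]
  show ?thesis
    unfolding clique_ratfun_linear_form rat_subst_prod[OF indep]
    by (intro prod.cong)
      (auto simp: rat_subst_power_int[OF indep] rat_subst_linear_form[OF assms] arcs_def)
qed

text \<open>
  A product over the arcs whose factors are 1 outside the image of a map of vertices is a
  product over the arcs of the source.
\<close>

lemma prod_arcs_vertex_map:
  assumes "strict_mono e"
    and arcs: "\<And>x y. (x, y) \<in> arcs n \<Longrightarrow> (e x, e y) \<in> arcs N"
    and label: "\<And>x y. (x, y) \<in> arcs n \<Longrightarrow> w (e x, e y) = v (x, y)"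
    and outside: "\<And>x y. (x, y) \<in> arcs N \<Longrightarrow> w (x, y) \<noteq> 0 \<Longrightarrow> \<exists>x' y'. (x', y') \<in> arcs n \<and> x = e x' \<and> y = e y'"
  shows "(\<Prod>(x, y)\<in>arcs n. linear_form (e x) (e y) powi v (x, y)) =
    (\<Prod>(x, y)\<in>arcs N. (linear_form x y :: 'k::field ratfun) powi w (x, y))"
proof -
  have inj: "inj_on (map_prod e e) (arcs n)"
    using strict_mono_eq[OF assms(1)] by (auto simp: inj_on_def)
  have "(\<Prod>(x, y)\<in>arcs N. (linear_form x y :: 'k ratfun) powi w (x, y)) =
      (\<Prod>(x, y)\<in>map_prod e e ` arcs n. linear_form x y powi w (x, y))"
  proof (rule prod.mono_neutral_right)
    show "\<forall>a\<in>arcs N - map_prod e e ` arcs n.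
        (case a of (x, y) \<Rightarrow> (linear_form x y :: 'k ratfun) powi w (x, y)) = 1"
    proof (clarify)
      fix x y
      assume a: "(x, y) \<in> arcs N" "(x, y) \<notin> map_prod e e ` arcs n"
      then have "w (x, y) = 0"
        using outside[OF a(1)] by force
      then show "(linear_form x y :: 'k ratfun) powi w (x, y) = 1"
        by simp
    qed
  qed (use arcs in auto)
  also have "\<dots> = (\<Prod>(x, y)\<in>arcs n. linear_form (e x) (e y) powi v (x, y))"
    unfolding prod.reindex[OF inj] using label by (intro prod.cong) auto
  finally show ?thesis ..
qed

context unitary_magma
begin

text \<open>
  The exponent of the linear form of an arc of \<open>p \<circ>\<^sub>i q\<close> is the sum of a contribution of \<open>p\<close> and
  one of \<open>q\<close>, each of them 0 if the arc does not come from the clique in question. The two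
  contributions meet at the arc \<open>(i, i + m)\<close> only, where \<open>\<theta>\<close> turns the product of the labels
  into a sum.
\<close>

lemma clique_ratfun_comp:
  assumes \<theta>: "rank_function M \<theta>"
    and p: "p \<in> cliques M n" and q: "q \<in> cliques M m" and "1 \<le> m" "i \<in> {1..n}"
  shows "clique_ratfun \<theta> (n + m - 1) (clique_comp M n m i p q) =
    rat_comp m i (clique_ratfun \<theta> n p) (clique_ratfun \<theta> m q :: 'k::field ratfun)"
proof -
  define \<alpha> where "\<alpha> = (\<lambda>(x, y). if y \<le> i then \<theta> (p (x, y))
    else if x \<le> i \<and> i + m \<le> y then \<theta> (p (x, y - m + 1))
    else if i + m \<le> x then \<theta> (p (x - m + 1, y - m + 1)) else 0)"
  define \<beta> where "\<beta> = (\<lambda>(x, y). if i \<le> x \<and> y \<le> i + m then \<theta> (q (x - i + 1, y - i + 1)) else 0)"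
  have \<theta>_one: "\<theta> \<one> = 0"
    using \<theta> by (simp add: rank_function_def unitary_magma_hom_def)
  have \<theta>_mult: "\<theta> (a \<otimes> b) = \<theta> a + \<theta> b" if "a \<in> carrier M" "b \<in> carrier M" for a b
    using \<theta> that by (auto simp: rank_function_def unitary_magma_hom_def hom_def)
  have exponent: "\<theta> (clique_comp M n m i p q (x, y)) = \<alpha> (x, y) + \<beta> (x, y)"
    if "(x, y) \<in> arcs (n + m - 1)" for x y
  proof -
    have "\<theta> (p (i, i + 1) \<otimes> q (1, m + 1)) = \<theta> (p (i, i + 1)) + \<theta> (q (1, m + 1))"
      using assms(4,5) by (intro \<theta>_mult clique_closed[OF p] clique_closed[OF q]) auto
    then show ?thesis
      using that assms(4,5)
      by (auto simp: clique_comp_apply arcs_def \<alpha>_def \<beta>_def \<theta>_one)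
  qed
  have outer: "(\<Prod>(x, y)\<in>arcs n.
        linear_form (outer_vertex m i x) (outer_vertex m i y) powi \<theta> (p (x, y))) =
      (\<Prod>(x, y)\<in>arcs (n + m - 1). (linear_form x y :: 'k ratfun) powi \<alpha> (x, y))"
  proof (rule prod_arcs_vertex_map[OF strict_mono_outer_vertex, where v = "\<lambda>a. \<theta> (p a)"])
    fix x y
    assume "(x, y) \<in> arcs (n + m - 1)" "\<alpha> (x, y) \<noteq> 0"
    then show "\<exists>x' y'. (x', y') \<in> arcs n \<and> x = outer_vertex m i x' \<and> y = outer_vertex m i y'"
      using assms(4,5)
      by (intro exI[of _ "if x \<le> i then x else x - m + 1"] exI[of _ "if y \<le> i then y else y - m + 1"])
        (auto simp: arcs_def outer_vertex_def \<alpha>_def split: if_splits)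
  qed (use assms(4,5) in \<open>auto simp: arcs_def outer_vertex_def \<alpha>_def\<close>)
  have inner: "(\<Prod>(x, y)\<in>arcs m.
        linear_form (inner_vertex i x) (inner_vertex i y) powi \<theta> (q (x, y))) =
      (\<Prod>(x, y)\<in>arcs (n + m - 1). (linear_form x y :: 'k ratfun) powi \<beta> (x, y))"
  proof (rule prod_arcs_vertex_map[OF strict_mono_inner_vertex, where v = "\<lambda>a. \<theta> (q a)"])
    fix x y
    assume "(x, y) \<in> arcs (n + m - 1)" "\<beta> (x, y) \<noteq> 0"
    then show "\<exists>x' y'. (x', y') \<in> arcs m \<and> x = inner_vertex i x' \<and> y = inner_vertex i y'"
      using assms(4,5)
      by (intro exI[of _ "x - i + 1"] exI[of _ "y - i + 1"])
        (auto simp: arcs_def inner_vertex_def \<beta>_def split: if_splits)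
  qed (use assms(4,5) in \<open>auto simp: arcs_def inner_vertex_def \<beta>_def\<close>)
  have "clique_ratfun \<theta> (n + m - 1) (clique_comp M n m i p q) =
      (\<Prod>(x, y)\<in>arcs (n + m - 1).
        (linear_form x y :: 'k ratfun) powi \<alpha> (x, y) * linear_form x y powi \<beta> (x, y))"
    unfolding clique_ratfun_linear_form
  proof (intro prod.cong refl, clarify)
    fix x y
    assume a: "(x, y) \<in> arcs (n + m - 1)"
    then have "linear_form x y \<noteq> (0 :: 'k ratfun)"
      by (intro linear_form_nonzero) (simp add: arcs_def)
    with a show "(linear_form x y :: 'k ratfun) powi \<theta> (clique_comp M n m i p q (x, y)) =
        linear_form x y powi \<alpha> (x, y) * linear_form x y powi \<beta> (x, y)"
      by (simp add: exponent power_int_add)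
  qed
  also have "\<dots> = (\<Prod>(x, y)\<in>arcs (n + m - 1). linear_form x y powi \<alpha> (x, y)) *
      (\<Prod>(x, y)\<in>arcs (n + m - 1). linear_form x y powi \<beta> (x, y))"
    by (simp add: case_prod_unfold prod.distrib)
  also have "\<dots> = rat_comp m i (clique_ratfun \<theta> n p) (clique_ratfun \<theta> m q)"
    using assms(4,5)
    by (simp add: rat_comp_vertex_subst rat_subst_clique_ratfun strict_mono_outer_vertex
        strict_mono_inner_vertex del: One_nat_def flip: outer inner)
  finally show ?thesis .
qed

end

lemma rank_map_0 [simp]: "rank_map \<theta> n 0 = 0"
  by (simp add: rank_map_def)

lemma rank_map_single [simp]:
  "rank_map \<theta> n (Poly_Mapping.single p a) = rat_const a * clique_ratfun \<theta> n p"
  by (simp add: rank_map_def)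

lemma rank_map_add: "rank_map \<theta> n (f + g) = rank_map \<theta> n f + rank_map \<theta> n g"
  unfolding rank_map_def
  by (intro setsum_keys_plus_distrib) (simp_all add: rat_const_add distrib_right)

lemma rank_map_scale: "rank_map \<theta> n (Poly_Mapping.map ((*) c) f) = rat_const c * rank_map \<theta> n f"
  using subset_UNIV
  by (induction f rule: poly_mapping_induct_keys)
    (simp_all add: map_times_add map_times_single rank_map_add rat_const_mult distrib_left mult.assoc)

lemma rank_map_in_ratfuns: "rank_map \<theta> n f \<in> ratfuns n"
  unfolding rank_map_def
  by (intro ratfuns_sum ratfuns_mult rat_const_in_ratfuns clique_ratfun_in_ratfuns)

lemma (in unitary_magma) rank_map_comp:
  assumes \<theta>: "rank_function M \<theta>"
    and f: "Poly_Mapping.keys f \<subseteq> cliques M n" and g: "Poly_Mapping.keys g \<subseteq> cliques M m"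
    and arity: "1 \<le> m" "i \<in> {1..n}"
  shows "rank_map \<theta> (n + m - 1) (clique_op_comp M n m i f g) =
    (rat_comp m i (rank_map \<theta> n f) (rank_map \<theta> m g) :: 'k::field ratfun)"
proof -
  have [simp]: "rat_comp m i (rat_const a * f') g' = rat_const a * rat_comp m i f' g'"
    "rat_comp m i f' (rat_const a * g') = rat_const a * rat_comp m i f' g'"
    "rat_comp m i (f' + f'') g' = rat_comp m i f' g' + rat_comp m i f'' g'"
    "rat_comp m i f' (g' + g'') = rat_comp m i f' g' + rat_comp m i f' g''"
    for a and f' f'' g' g'' :: "'k ratfun"
    using arity by (simp_all add: rat_comp_scale_left rat_comp_scale_right rat_comp_add_left rat_comp_add_right)
  have [simp]: "rat_comp m i 0 g' = 0" "rat_comp m i f' 0 = 0" for f' g' :: "'k ratfun"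
    using rat_comp_scale_left[of m i 0 0 g'] rat_comp_scale_right[of m i f' 0 0] arity by simp_all
  show ?thesis
    using f
  proof (induction f rule: poly_mapping_induct_keys)
    case p: (single p a)
    show ?case
      using g
    proof (induction g rule: poly_mapping_induct_keys)
      case q: (single q b)
      show ?case
        by (simp add: clique_ratfun_comp[OF \<theta> p q arity] rat_const_mult mult.assoc del: One_nat_def)
    qed (simp_all add: clique_op_comp_add_right rank_map_add)
  qed (simp_all add: clique_op_comp_add_left rank_map_add)
qed

theorem theorem2p2p10:
  fixes M :: "('m, 'x) monoid_scheme"
    and \<theta> :: "'m \<Rightarrow> int"
  assumes "int_graded_unitary_magma M"
    and "rank_function M \<theta>"
  shows "operad_morphism
    (clique_operad M :: ('k::field_char_0, 'm clique \<Rightarrow>\<^sub>0 'k) operad_struct)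
    rat_fct_operad (rank_map \<theta>)"
proof -
  interpret unitary_magma M
    using assms(1) by (simp add: int_graded_unitary_magma_def)
  have "\<theta> \<one>\<^bsub>M\<^esub> = 0"
    using assms(2) by (simp add: rank_function_def unitary_magma_hom_def)
  then have one: "rank_map \<theta> 1 (Poly_Mapping.single (unit_clique M) 1) = (1 :: 'k ratfun)"
    by (auto simp: clique_ratfun_def unit_clique_def intro!: prod.neutral)
  show ?thesis
  proof (intro operad_morphism.intro operad_clique operad_rat_fct operad_morphism_axioms.intro,
      unfold clique_operad_simps mem_Collect_eq)
    show "rank_map \<theta> n f \<in> op_space rat_fct_operad n" for n and f :: "'m clique \<Rightarrow>\<^sub>0 'k"
      by (simp add: rat_fct_operad_def rank_map_in_ratfuns)
    show "rank_map \<theta> (n + m - 1) (clique_op_comp M n m i f g) =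
        op_comp rat_fct_operad n m i (rank_map \<theta> n f) (rank_map \<theta> m g)"
      if "Poly_Mapping.keys f \<subseteq> cliques M n" "Poly_Mapping.keys g \<subseteq> cliques M m" "1 \<le> m" "i \<in> {1..n}"
      for n m i and f g :: "'m clique \<Rightarrow>\<^sub>0 'k"
      using rank_map_comp[OF assms(2) that] by (simp add: rat_fct_operad_def)
  qed (use one in \<open>simp_all add: rat_fct_operad_def rank_map_add rank_map_scale\<close>)
qed

end
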